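(* Let $d\ge1$ and let $x_1,\dots,x_T$ be points drawn independently and uniformly at random from the cube $[0,1]^d$, revealed one at a time. There is an online algorithm which selects signs $\chi_t\in\{\pm1\}$ such that, with high probability, for each $i\in[d]$ and each interval $I\subseteq[0,1]$, \[\max_{t\in[T]}\mathsf{disc}^i_t(I)=O(d\log^3T).\] Moreover, with constant probability, for any online algorithm there exist an interval $I$ and a coordinate $i\in[d]$ such that $\max_{t\in[T]}\mathsf{disc}^i_t(I)=\Omega\big(\sqrt{d\log(T/d)}\big)$.
   Context: For a point $x\in[0,1]^d$, $x(i)$ denotes its $i$-th coordinate. For a signing $\chi_1,\dots,\chi_T$, an interval $I\subseteq[0,1]$ and $i\in[d]$, $\mathsf{disc}^i_t(I):=\left|\sum_{s=1}^t\chi_s\mathbf{1}_I(x_s(i))\right|$. An online algorithm must choose $\chi_t$ irrevocably after seeing $x_1,\dots,x_t$ only. "With high probability" means with probability $1-1/\mathrm{poly}(d,T)$, where the exponent can be made as large as desired by increasing the constant in the bound. Logarithms are base $2$. *)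

theory Defs
  imports "HOL-Probability.Probability"
begin

text \<open>Points of the cube are functions on the coordinates \<open>{1..d}\<close> and inputs are functions on the
  times \<open>{1..T}\<close>, since the constants of the theorem must be uniform in \<open>d\<close> and \<open>T\<close>.\<close>

definition uniform_cube :: "nat \<Rightarrow> (nat \<Rightarrow> real) measure" where
  "uniform_cube d = (\<Pi>\<^sub>M i\<in>{1..d}. uniform_measure lborel {0..1})"

definition iid_points :: "nat \<Rightarrow> nat \<Rightarrow> (nat \<Rightarrow> nat \<Rightarrow> real) measure" where
  "iid_points d T = (\<Pi>\<^sub>M s\<in>{1..T}. uniform_cube d)"

text \<open>\<open>A t h\<close> is the sign chosen at time \<open>t\<close> when the history \<open>h\<close> consists of the first \<open>t\<close> points.\<close>

definition online_algorithm ::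
    "nat \<Rightarrow> nat \<Rightarrow> (nat \<Rightarrow> (nat \<Rightarrow> nat \<Rightarrow> real) \<Rightarrow> real) \<Rightarrow> bool" where
  "online_algorithm d T A \<longleftrightarrow>
     (\<forall>t\<in>{1..T}. A t \<in> iid_points d t \<rightarrow>\<^sub>M count_space {-1, 1})"

text \<open>A randomized algorithm draws a seed from \<open>R\<close>, independent of the input, and then proceeds online.
  The deterministic case is that of an algorithm ignoring its seed.\<close>

definition randomized_online_algorithm ::
    "'r measure \<Rightarrow> nat \<Rightarrow> nat \<Rightarrow> (nat \<Rightarrow> 'r \<Rightarrow> (nat \<Rightarrow> nat \<Rightarrow> real) \<Rightarrow> real) \<Rightarrow> bool" where
  "randomized_online_algorithm R d T A \<longleftrightarrow> prob_space R \<and>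
     (\<forall>t\<in>{1..T}. (\<lambda>(r, h). A t r h) \<in> R \<Otimes>\<^sub>M iid_points d t \<rightarrow>\<^sub>M count_space {-1, 1})"

definition signing ::
    "(nat \<Rightarrow> (nat \<Rightarrow> nat \<Rightarrow> real) \<Rightarrow> real) \<Rightarrow> (nat \<Rightarrow> nat \<Rightarrow> real) \<Rightarrow> nat \<Rightarrow> real" where
  "signing A x t = A t (restrict x {1..t})"

definition disc ::
    "(nat \<Rightarrow> real) \<Rightarrow> (nat \<Rightarrow> nat \<Rightarrow> real) \<Rightarrow> nat \<Rightarrow> nat \<Rightarrow> real set \<Rightarrow> real" where
  "disc \<epsilon> x i t I = \<bar>\<Sum>s=1..t. \<epsilon> s * indicator I (x s i)\<bar>"

end

theory Submission
  imports Defs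
begin

text \<open>
  Both bounds compare the signing with the Haar functions \<open>v\<^sub>a\<close> of the \<open>d\<close> coordinates, of \<open>L\<close> dyadic
  levels each, together with the constant function. Write \<open>D\<^sub>a\<close> for the signed sum of \<open>v\<^sub>a\<close> over the points
  seen so far, and \<open>G = d L + 1\<close> for the number of pairs of a coordinate and a level.

  Upper bound: with \<open>2\<^sup>L\<close> about \<open>T\<^sup>2\<close> and \<open>\<lambda> = 1/G\<close>, choose each sign so as to minimise
  \<open>\<Phi> = \<Sum> cosh (\<lambda> D\<^sub>a)\<close>. As the \<open>v\<^sub>a\<close> are orthogonal and of disjoint supports within a level, testing
  \<open>Y = \<Sum> sinh (\<lambda> D\<^sub>a) v\<^sub>a\<close> against a combination of the functions of one level with signs as coefficients
  gives \<open>E \<bar>Y\<bar> \<ge> (1/G) \<Sum> \<bar>sinh (\<lambda> D\<^sub>a)\<bar> E \<bar>v\<^sub>a\<bar>\<close>. This drift outweighs the second order term up to a constant,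
  so \<open>\<Phi>\<close> stays polynomial in expectation and \<open>D\<^sub>a = O(G log T)\<close> with high probability. Each level adds
  at most \<open>max \<bar>D\<^sub>a\<bar> / 2\<close> to the discrepancy of dyadic prefixes, and the at most two boundary cells of
  an interval contain a bounded number of points.

  Lower bound: with \<open>2\<^sup>L\<close> about \<open>T/d\<close>, orthogonality gives \<open>E \<bar>\<Sum> D\<^sub>a v\<^sub>a\<bar> \<le> sqrt G max \<bar>D\<^sub>a\<bar>\<close>. Hence \<open>\<Sum> D\<^sub>a\<^sup>2\<close>
  grows by at least \<open>G/2\<close> per step in expectation as long as \<open>max \<bar>D\<^sub>a\<bar> \<le> sqrt G / 4\<close>, whatever the
  signs are. The sum has at most \<open>d 2\<^sup>L\<close> terms, so this cannot last for \<open>T\<close> steps.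
\<close>

declare One_nat_def [simp del]

section \<open>Averaging over one point, and a hyperbolic inequality\<close>

text \<open>Stands in for conditioning on all points except that of time \<open>t\<close>: Fubini
  integrates this point first. The condition \<open>0 <= C\<close> also covers the default value 0
  of a Bochner integral, so integrability of the inner integral need not be shown.\<close>

lemma (in prob_space) expectation_component_le:
  assumes "t \<in> {1..T::nat}" and "integrable (\<Pi>\<^sub>M s\<in>{1..T}. M) f" and "0 \<le> C"
    and "\<And>x. x \<in> space (\<Pi>\<^sub>M s\<in>{1..T} - {t}. M) \<Longrightarrow> (\<integral>y. f (x(t := y)) \<partial>M) \<le> (C::real)"
  shows "(\<integral>x. f x \<partial>(\<Pi>\<^sub>M s\<in>{1..T}. M)) \<le> C"
proof -
  interpret Q: product_sigma_finite "\<lambda>s::nat. M" ..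
  have ins: "insert t ({1..T} - {t}) = {1..T}"
    using assms(1) by auto
  have eq: "(\<integral>x. f x \<partial>(\<Pi>\<^sub>M s\<in>{1..T}. M)) = (\<integral>x. (\<integral>y. f (x(t := y)) \<partial>M) \<partial>(\<Pi>\<^sub>M s\<in>{1..T} - {t}. M))"
    using Q.product_integral_insert[of "{1..T} - {t}" t f] assms(2) unfolding ins by simp
  show ?thesis
  proof (cases "integrable (\<Pi>\<^sub>M s\<in>{1..T} - {t}. M) (\<lambda>x. \<integral>y. f (x(t := y)) \<partial>M)")
    case True
    interpret Q': prob_space "\<Pi>\<^sub>M s\<in>{1..T} - {t}. M"
      by (intro prob_space_PiM) (rule prob_space_axioms)
    show ?thesis
      unfolding eq by (rule Q'.integral_le_const[OF True]) (use assms(4) in auto)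
  next
    case False
    then show ?thesis
      unfolding eq by (simp add: not_integrable_integral_eq assms(3))
  qed
qed

text \<open>By the mean value theorem. At \<open>z = 1 / card Groups\<close> it makes the second
  order factor of a potential step at most \<open>1 / card Groups\<close> times the drift factor
  \<open>sinh z\<close>.\<close>

lemma cosh_minus_one_le:
  assumes "0 \<le> (z::real)"
  shows "cosh z - 1 \<le> z * sinh z"
proof (cases "z = 0")
  case False
  with assms have "0 < z" by simp
  have "\<exists>u. 0 < u \<and> u < z \<and> cosh z - cosh 0 = (z - 0) * sinh u"
    by (rule MVT2[OF \<open>0 < z\<close>]) (auto intro!: derivative_eq_intros)
  then obtain u where u: "0 < u" "u < z" "cosh z - 1 = z * sinh u"
    by auto
  have "sinh u \<le> sinh z"
    using u by simp
  then show ?thesis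
    using u(3) assms by (simp add: mult_left_mono)
qed simp

section \<open>Sign systems: duality and orthogonality\<close>

text \<open>The abstraction of the Haar system: a group consists of the functions of one level in one
  coordinate, so that its supports partition the space.\<close>

locale sign_system = prob_space M
  for M :: "'y measure" +
  fixes J :: "'a set" and Groups :: "'g set" and grp :: "'a \<Rightarrow> 'g"
    and v :: "'a \<Rightarrow> 'y \<Rightarrow> real" and w :: "'a \<Rightarrow> real"
  assumes finite_J: "finite J" and finite_Groups: "finite Groups" and Groups_ne: "Groups \<noteq> {}"
    and grp: "a \<in> J \<Longrightarrow> grp a \<in> Groups"
    and measurable_v[measurable]: "a \<in> J \<Longrightarrow> v a \<in> borel_measurable M"
    and v_values: "v a y \<in> {-1, 0, 1}"
    and v_disjoint: "\<lbrakk>a \<in> J; b \<in> J; a \<noteq> b; grp a = grp b\<rbrakk> \<Longrightarrow> v a y = 0 \<or> v b y = 0"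
    and orthogonal: "\<lbrakk>a \<in> J; b \<in> J\<rbrakk> \<Longrightarrow> expectation (\<lambda>y. v a y * v b y) = (if a = b then w a else 0)"
    and group_weight: "\<gamma> \<in> Groups \<Longrightarrow> (\<Sum>a\<in>{a\<in>J. grp a = \<gamma>}. w a) = 1"
begin

text \<open>Governs the first order change of both potentials: with \<open>D\<close> the current
  signed counts, \<open>s a = sinh (rate * D a)\<close> belongs to the exponential one and
  \<open>s a = D a\<close> to the quadratic one. The upper bound needs its mean modulus to be large,
  the lower bound needs it to be small.\<close>

definition lin :: "('a \<Rightarrow> real) \<Rightarrow> 'y \<Rightarrow> real" where
  "lin s y = (\<Sum>a\<in>J. s a * v a y)"

lemma abs_v_le_1: "\<bar>v a y\<bar> \<le> 1"
  using v_values[of a y] by auto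

lemma v_square: "v a y * v a y = \<bar>v a y\<bar>"
  using v_values[of a y] by auto

lemma measurable_lin[measurable]: "lin s \<in> borel_measurable M"
  unfolding lin_def by measurable

lemma abs_lin_le: "\<bar>lin s y\<bar> \<le> (\<Sum>a\<in>J. \<bar>s a\<bar>)"
  unfolding lin_def
  by (rule order_trans[OF sum_abs sum_mono]) (simp add: abs_mult mult_left_le abs_v_le_1)

lemma integrable_v: "a \<in> J \<Longrightarrow> integrable M (v a)"
  by (rule integrable_const_bound[where B = 1]) (auto simp: abs_v_le_1)

lemma integrable_v_v:
  assumes "a \<in> J" "b \<in> J"
  shows "integrable M (\<lambda>y. v a y * v b y)"
  by (rule integrable_const_bound[where B = 1])
    (use assms abs_v_le_1 in \<open>auto simp: abs_mult mult_le_one\<close>)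

lemma integrable_lin: "integrable M (lin s)"
  by (rule integrable_const_bound[where B = "\<Sum>a\<in>J. \<bar>s a\<bar>"]) (auto simp: abs_lin_le)

lemma expectation_abs_v: "a \<in> J \<Longrightarrow> expectation (\<lambda>y. \<bar>v a y\<bar>) = w a"
  using orthogonal[of a a] by (simp add: v_square)

lemma w_nonneg: "a \<in> J \<Longrightarrow> 0 \<le> w a"
  using expectation_abs_v[of a] by (metis integral_nonneg_AE AE_I2 abs_ge_zero)

lemma integrable_lin_lin: "integrable M (\<lambda>y. lin s y * lin r y)"
  by (rule integrable_const_bound[where B = "(\<Sum>a\<in>J. \<bar>s a\<bar>) * (\<Sum>a\<in>J. \<bar>r a\<bar>)"])
    (auto simp: abs_mult intro!: mult_mono abs_lin_le)

lemma expectation_lin_lin: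
  "expectation (\<lambda>y. lin s y * lin r y) = (\<Sum>a\<in>J. s a * r a * w a)"
proof -
  have "expectation (\<lambda>y. lin s y * lin r y)
      = expectation (\<lambda>y. \<Sum>a\<in>J. \<Sum>b\<in>J. (s a * r b) * (v a y * v b y))"
    unfolding lin_def sum_product by (simp only: mult.assoc mult.left_commute)
  also have "\<dots> = (\<Sum>a\<in>J. \<Sum>b\<in>J. (s a * r b) * expectation (\<lambda>y. v a y * v b y))"
    using integrable_v_v by (simp add: Bochner_Integration.integral_sum integrable_sum)
  also have "\<dots> = (\<Sum>a\<in>J. \<Sum>b\<in>J. if a = b then s a * r a * w a else 0)"
    by (intro sum.cong refl) (simp add: orthogonal)
  finally show ?thesis
    by (simp add: finite_J)
qed

lemma sum_by_groups: "(\<Sum>a\<in>J. f a) = (\<Sum>\<gamma>\<in>Groups. \<Sum>a\<in>{a\<in>J. grp a = \<gamma>}. f a)"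
  by (rule sum.group[symmetric, OF finite_J finite_Groups]) (use grp in auto)

lemma sum_w: "(\<Sum>a\<in>J. w a) = card Groups"
  using sum_by_groups[of w] by (simp add: group_weight)

text \<open>Duality: test against the unimodular function \<open>\<Sum> sgn (s a) v a\<close> of the group.\<close>

lemma group_sum_le_expectation_abs_lin:
  assumes "\<gamma> \<in> Groups"
  shows "(\<Sum>a\<in>{a\<in>J. grp a = \<gamma>}. \<bar>s a\<bar> * w a) \<le> expectation (\<lambda>y. \<bar>lin s y\<bar>)"
proof -
  define r where "r a = (if grp a = \<gamma> then sgn (s a) else 0)" for a
  have r1: "\<bar>r a\<bar> \<le> 1" for a
    by (simp add: r_def sgn_if)
  \<comment> \<open>The supports within a group are disjoint, so at most one summand is nonzero at
    each point.\<close>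
  have lin_r: "\<bar>lin r y\<bar> \<le> 1" for y
  proof (cases "\<exists>b\<in>J. grp b = \<gamma> \<and> v b y \<noteq> 0")
    case True
    then obtain b where b: "b \<in> J" "grp b = \<gamma>" "v b y \<noteq> 0" by auto
    have "r a * v a y = (if a = b then r b * v b y else 0)" if "a \<in> J" for a
      using v_disjoint[of a b y] b that by (auto simp: r_def)
    then have "lin r y = (\<Sum>a\<in>J. if a = b then r b * v b y else 0)"
      unfolding lin_def by (rule sum.cong[OF refl])
    then have "lin r y = r b * v b y"
      by (simp add: finite_J b(1))
    then show ?thesis
      using r1[of b] abs_v_le_1[of b y] by (simp add: abs_mult mult_le_one)
  next
    case False
    then have "lin r y = 0"
      unfolding lin_def by (intro sum.neutral) (auto simp: r_def)
    then show ?thesis by simp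
  qed
  have "(\<Sum>a\<in>{a\<in>J. grp a = \<gamma>}. \<bar>s a\<bar> * w a) = (\<Sum>a\<in>J. s a * r a * w a)"
    by (rule sum.mono_neutral_cong_left) (auto simp: finite_J r_def abs_sgn)
  also have "\<dots> = expectation (\<lambda>y. lin s y * lin r y)"
    by (simp add: expectation_lin_lin)
  also have "\<dots> \<le> expectation (\<lambda>y. \<bar>lin s y\<bar>)"
  proof (rule integral_mono)
    show "lin s y * lin r y \<le> \<bar>lin s y\<bar>" for y
      using mult_left_le[OF lin_r[of y], of "\<bar>lin s y\<bar>"] by (simp flip: abs_mult)
  qed (use integrable_lin_lin integrable_lin in auto)
  finally show ?thesis .
qed

text \<open>Adds up the duality bound over the groups. The factor \<open>card Groups\<close> lost
  here dictates \<open>rate\<close>.\<close>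

lemma sum_le_expectation_abs_lin:
  "(\<Sum>a\<in>J. \<bar>s a\<bar> * w a) \<le> card Groups * expectation (\<lambda>y. \<bar>lin s y\<bar>)"
  unfolding sum_by_groups[of "\<lambda>a. \<bar>s a\<bar> * w a"]
  by (rule sum_bounded_above) (rule group_sum_le_expectation_abs_lin)

text \<open>Cauchy-Schwarz, in the form of a nonnegative variance, followed by
  orthogonality.\<close>

lemma expectation_abs_lin_le:
  "expectation (\<lambda>y. \<bar>lin s y\<bar>) \<le> sqrt (\<Sum>a\<in>J. (s a)\<^sup>2 * w a)"
proof (rule real_le_rsqrt)
  have i: "integrable M (\<lambda>y. \<bar>lin s y\<bar>)" "integrable M (\<lambda>y. \<bar>lin s y\<bar>\<^sup>2)"
    using integrable_lin[of s] integrable_lin_lin[of s s] by (auto simp: power2_eq_square)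
  have "0 \<le> variance (\<lambda>y. \<bar>lin s y\<bar>)"
    by (rule variance_positive)
  also have "\<dots> = expectation (\<lambda>y. \<bar>lin s y\<bar>\<^sup>2) - (expectation (\<lambda>y. \<bar>lin s y\<bar>))\<^sup>2"
    by (rule variance_eq[OF i])
  also have "expectation (\<lambda>y. \<bar>lin s y\<bar>\<^sup>2) = (\<Sum>a\<in>J. (s a)\<^sup>2 * w a)"
    using expectation_lin_lin[of s s] by (simp add: power2_eq_square)
  finally show "(expectation (\<lambda>y. \<bar>lin s y\<bar>))\<^sup>2 \<le> (\<Sum>a\<in>J. (s a)\<^sup>2 * w a)"
    by simp
qed

definition signed_count :: "(nat \<Rightarrow> real) \<Rightarrow> (nat \<Rightarrow> 'y) \<Rightarrow> nat \<Rightarrow> 'a \<Rightarrow> real" where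
  "signed_count \<epsilon> x t a = (\<Sum>s=1..t. \<epsilon> s * v a (x s))"

lemma signed_count_0[simp]: "signed_count \<epsilon> x 0 a = 0"
  by (simp add: signed_count_def)

lemma signed_count_Suc:
  "signed_count \<epsilon> x (Suc t) a = signed_count \<epsilon> x t a + \<epsilon> (Suc t) * v a (x (Suc t))"
  by (simp add: signed_count_def)

lemma abs_signed_count_le:
  assumes "\<And>s. s \<in> {1..t} \<Longrightarrow> \<bar>\<epsilon> s\<bar> \<le> 1"
  shows "\<bar>signed_count \<epsilon> x t a\<bar> \<le> t"
proof -
  have "\<bar>signed_count \<epsilon> x t a\<bar> \<le> (\<Sum>s=1..t. \<bar>\<epsilon> s * v a (x s)\<bar>)"
    unfolding signed_count_def by (rule sum_abs)
  also have "\<dots> \<le> (\<Sum>s=1..t. 1)"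
    by (rule sum_mono) (use assms abs_v_le_1 in \<open>auto simp: abs_mult mult_le_one\<close>)
  finally show ?thesis by simp
qed

subsection \<open>The greedy algorithm for the exponential potential\<close>

definition rate :: real where "rate = 1 / card Groups"

text \<open>By the addition formula for \<open>cosh\<close>, the sign enters the next potential only
  through a positive multiple of its product with this \<open>lin\<close>. Opposing the sign of
  \<open>lin\<close> therefore minimises the potential.\<close>

definition greedy_sign :: "('a \<Rightarrow> real) \<Rightarrow> 'y \<Rightarrow> real" where
  "greedy_sign s y = (if 0 < lin (\<lambda>a. sinh (rate * s a)) y then -1 else 1)"

text \<open>Signs and counts determine each other; carrying the counts as a state makes the
  recursion primitive. \<open>greedy_state_eq\<close> identifies the state with
  \<open>signed_count\<close>.\<close>

primrec greedy_state :: "(nat \<Rightarrow> 'y) \<Rightarrow> nat \<Rightarrow> 'a \<Rightarrow> real" where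
  "greedy_state x 0 = (\<lambda>a. 0)"
| "greedy_state x (Suc t) =
     (\<lambda>a. greedy_state x t a + greedy_sign (greedy_state x t) (x (Suc t)) * v a (x (Suc t)))"

definition greedy :: "nat \<Rightarrow> (nat \<Rightarrow> 'y) \<Rightarrow> real" where
  "greedy t x = greedy_sign (greedy_state x (t - 1)) (x t)"

definition potential :: "('a \<Rightarrow> real) \<Rightarrow> real" where
  "potential s = (\<Sum>a\<in>J. cosh (rate * s a))"

text \<open>Gives both that the signs are chosen online and that replacing a later point leaves the
  state fixed when that point is averaged out.\<close>

lemma greedy_state_cong:
  "(\<And>s. s \<in> {1..t} \<Longrightarrow> x s = x' s) \<Longrightarrow> greedy_state x t = greedy_state x' t"
  by (induction t) auto

lemma greedy_cong:
  assumes "\<And>s. s \<in> {1..t} \<Longrightarrow> x s = x' s" "1 \<le> t"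
  shows "greedy t x = greedy t x'"
proof -
  have "greedy_state x (t - 1) = greedy_state x' (t - 1)"
    by (rule greedy_state_cong) (use assms(1) in auto)
  then show ?thesis
    using assms by (simp add: greedy_def)
qed

lemma greedy_state_eq: "greedy_state x t = signed_count (\<lambda>s. greedy s x) x t"
  by (induction t) (auto simp: signed_count_Suc greedy_def)

lemma abs_greedy: "\<bar>greedy t x\<bar> = 1"
  by (simp add: greedy_def greedy_sign_def)

lemma measurable_greedy_state:
  assumes "t \<le> T" "a \<in> J"
  shows "(\<lambda>x. greedy_state x t a) \<in> borel_measurable (\<Pi>\<^sub>M s\<in>{1..T}. M)"
  using assms
proof (induction t arbitrary: a)
  case (Suc t)
  then have [measurable]: "\<And>a. a \<in> J \<Longrightarrow> (\<lambda>x. greedy_state x t a) \<in> borel_measurable (\<Pi>\<^sub>M s\<in>{1..T}. M)"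
    by simp
  have [measurable]: "(\<lambda>x. x (Suc t)) \<in> (\<Pi>\<^sub>M s\<in>{1..T}. M) \<rightarrow>\<^sub>M M"
    using Suc.prems(1) by (intro measurable_component_singleton) auto
  have [measurable]: "(\<lambda>x. v a (x (Suc t))) \<in> borel_measurable (\<Pi>\<^sub>M s\<in>{1..T}. M)" if "a \<in> J" for a
    using that by measurable
  have [measurable]: "sinh \<in> borel_measurable (borel :: real measure)"
    by (intro borel_measurable_continuous_onI continuous_intros)
  show ?case
    using Suc.prems(2) unfolding greedy_state.simps greedy_sign_def lin_def by measurable
qed simp

lemma measurable_greedy:
  assumes "t \<in> {1..T}"
  shows "greedy t \<in> (\<Pi>\<^sub>M s\<in>{1..T}. M) \<rightarrow>\<^sub>M count_space {-1, 1}"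
proof -
  have [measurable]: "\<And>a. a \<in> J \<Longrightarrow> (\<lambda>x. greedy_state x (t - 1) a) \<in> borel_measurable (\<Pi>\<^sub>M s\<in>{1..T}. M)"
    using assms by (intro measurable_greedy_state) auto
  have [measurable]: "(\<lambda>x. x t) \<in> (\<Pi>\<^sub>M s\<in>{1..T}. M) \<rightarrow>\<^sub>M M"
    using assms by (intro measurable_component_singleton)
  have [measurable]: "(\<lambda>x. v a (x t)) \<in> borel_measurable (\<Pi>\<^sub>M s\<in>{1..T}. M)" if "a \<in> J" for a
    using that by measurable
  have [measurable]: "sinh \<in> borel_measurable (borel :: real measure)"
    by (intro borel_measurable_continuous_onI continuous_intros)
  show ?thesis
    unfolding greedy_def greedy_sign_def lin_def by measurable
qed

text \<open>An identity instead of a Taylor estimate, because \<open>v a y\<close> is -1, 0 or 1.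
  The last term is negative by the greedy choice.\<close>

lemma potential_step:
  "potential (\<lambda>a. s a + greedy_sign s y * v a y) = potential s
     + ((cosh rate - 1) * (\<Sum>a\<in>J. cosh (rate * s a) * \<bar>v a y\<bar>)
        - sinh rate * \<bar>lin (\<lambda>a. sinh (rate * s a)) y\<bar>)"
proof -
  define \<epsilon> where "\<epsilon> = greedy_sign s y"
  have \<epsilon>: "\<epsilon> = 1 \<or> \<epsilon> = -1"
    by (auto simp: \<epsilon>_def greedy_sign_def)
  have "cosh (rate * (s a + \<epsilon> * v a y)) = cosh (rate * s a)
      + (cosh rate - 1) * (cosh (rate * s a) * \<bar>v a y\<bar>)
      + \<epsilon> * sinh rate * (sinh (rate * s a) * v a y)" for a
    using v_values[of a y] \<epsilon>
    by (auto simp: cosh_add cosh_diff algebra_simps)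
  then have "potential (\<lambda>a. s a + \<epsilon> * v a y) = potential s
      + (cosh rate - 1) * (\<Sum>a\<in>J. cosh (rate * s a) * \<bar>v a y\<bar>)
      + \<epsilon> * sinh rate * lin (\<lambda>a. sinh (rate * s a)) y"
    by (simp add: potential_def lin_def sum.distrib sum_distrib_left)
  moreover have "\<epsilon> * lin (\<lambda>a. sinh (rate * s a)) y = - \<bar>lin (\<lambda>a. sinh (rate * s a)) y\<bar>"
    by (auto simp: \<epsilon>_def greedy_sign_def)
  then have "\<epsilon> * sinh rate * lin (\<lambda>a. sinh (rate * s a)) y
      = - (sinh rate * \<bar>lin (\<lambda>a. sinh (rate * s a)) y\<bar>)"
    by (metis mult.commute mult.left_commute mult_minus_left)
  ultimately show ?thesis
    by (simp add: \<epsilon>_def[symmetric])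
qed

text \<open>The third inequality is the purpose of \<open>rate\<close>: it follows from
  \<open>cosh_minus_one_le\<close> since \<open>rate * card Groups = 1\<close>. The last one
  supplies the constant 2 of the increment per step.\<close>

lemma rate_bounds: "0 < rate" "rate \<le> 1"
  "(cosh rate - 1) * card Groups \<le> sinh rate" "sinh rate \<le> 2"
proof -
  have n: "1 \<le> card Groups"
    using finite_Groups Groups_ne by (metis One_nat_def Suc_leI card_gt_0_iff)
  then show r: "0 < rate" "rate \<le> 1"
    by (auto simp: rate_def)
  have "(cosh rate - 1) * card Groups \<le> rate * sinh rate * card Groups"
    using cosh_minus_one_le[of rate] r by (intro mult_right_mono) auto
  also have "\<dots> = sinh rate"
    using n by (simp add: rate_def)
  finally show "(cosh rate - 1) * card Groups \<le> sinh rate" .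
  have "sinh rate \<le> sinh 1"
    using r by simp
  \<comment> \<open>\<open>sinh 1\<close> is at most half of \<open>exp 1\<close>, and
    \<open>exp 1\<close> is at most 3.\<close>
  also have "\<dots> \<le> 2"
    using exp_le exp_gt_zero[of "-1::real"] by (simp add: sinh_field_def del: exp_gt_zero)
  finally show "sinh rate \<le> 2" .
qed

text \<open>Since \<open>cosh\<close> is at most 1 plus the modulus of \<open>sinh\<close>, the
  second order sum is at most \<open>card Groups\<close> plus a sum that duality bounds by
  \<open>card Groups * E\<close>. The drift \<open>sinh rate * E\<close> absorbs the part with
  \<open>E\<close>, however large the counts are, and what remains is at most
  \<open>sinh rate\<close>.\<close>

lemma expected_potential_increment_le:
  "expectation (\<lambda>y. (cosh rate - 1) * (\<Sum>a\<in>J. cosh (rate * s a) * \<bar>v a y\<bar>)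
      - sinh rate * \<bar>lin (\<lambda>a. sinh (rate * s a)) y\<bar>) \<le> 2"
proof -
  define E where "E = expectation (\<lambda>y. \<bar>lin (\<lambda>a. sinh (rate * s a)) y\<bar>)"
  have "0 \<le> E"
    unfolding E_def by (rule integral_nonneg_AE) auto
  have i: "integrable M (\<lambda>y. \<Sum>a\<in>J. cosh (rate * s a) * \<bar>v a y\<bar>)"
    using integrable_v by auto
  have "expectation (\<lambda>y. (cosh rate - 1) * (\<Sum>a\<in>J. cosh (rate * s a) * \<bar>v a y\<bar>)
      - sinh rate * \<bar>lin (\<lambda>a. sinh (rate * s a)) y\<bar>)
      = (cosh rate - 1) * expectation (\<lambda>y. \<Sum>a\<in>J. cosh (rate * s a) * \<bar>v a y\<bar>) - sinh rate * E"
    using i integrable_lin by (subst Bochner_Integration.integral_diff) (auto simp: E_def)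
  also have "expectation (\<lambda>y. \<Sum>a\<in>J. cosh (rate * s a) * \<bar>v a y\<bar>) = (\<Sum>a\<in>J. cosh (rate * s a) * w a)"
    using integrable_v by (subst Bochner_Integration.integral_sum) (auto simp: expectation_abs_v)
  also have "(cosh rate - 1) * (\<Sum>a\<in>J. cosh (rate * s a) * w a)
      \<le> (cosh rate - 1) * (card Groups + card Groups * E)"
  proof (rule mult_left_mono)
    have "(\<Sum>a\<in>J. cosh (rate * s a) * w a) \<le> (\<Sum>a\<in>J. w a + \<bar>sinh (rate * s a)\<bar> * w a)"
    proof (rule sum_mono)
      fix a assume "a \<in> J"
      have "cosh (rate * s a) \<le> 1 + \<bar>sinh (rate * s a)\<bar>"
      proof (rule power2_le_imp_le)
        show "(cosh (rate * s a))\<^sup>2 \<le> (1 + \<bar>sinh (rate * s a)\<bar>)\<^sup>2"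
          by (simp add: cosh_square_eq power2_sum)
      qed simp
      then show "cosh (rate * s a) * w a \<le> w a + \<bar>sinh (rate * s a)\<bar> * w a"
        using mult_right_mono[OF _ w_nonneg[OF \<open>a \<in> J\<close>], of _ "1 + \<bar>sinh (rate * s a)\<bar>"]
        by (simp add: distrib_right)
    qed
    also have "\<dots> \<le> card Groups + card Groups * E"
      unfolding E_def sum.distrib sum_w using sum_le_expectation_abs_lin by simp
    finally show "(\<Sum>a\<in>J. cosh (rate * s a) * w a) \<le> card Groups + card Groups * E" .
  qed (simp add: cosh_real_ge_1)
  also have "\<dots> - sinh rate * E
      = (cosh rate - 1) * card Groups + ((cosh rate - 1) * card Groups - sinh rate) * E"
    by (simp add: algebra_simps)
  also have "\<dots> \<le> 2 + 0"
    using rate_bounds \<open>0 \<le> E\<close> by (intro add_mono mult_nonpos_nonneg) auto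
  finally show ?thesis by simp
qed

lemma abs_greedy_state_le: "\<bar>greedy_state x t a\<bar> \<le> t"
  unfolding greedy_state_eq by (rule abs_signed_count_le) (simp add: abs_greedy)

text \<open>The crude upper bound is for integrability; nonnegativity is also what Markov's
  inequality asks for.\<close>

lemma potential_greedy_state_bounds:
  "0 \<le> potential (greedy_state x t)" "potential (greedy_state x t) \<le> card J * cosh (real t)"
proof -
  show "0 \<le> potential (greedy_state x t)"
    unfolding potential_def by (intro sum_nonneg) simp
  have "cosh (rate * greedy_state x t a) \<le> cosh (real t)" for a
  proof -
    have "\<bar>rate * greedy_state x t a\<bar> \<le> 1 * real t"
      unfolding abs_mult using rate_bounds abs_greedy_state_le[of x t a] by (intro mult_mono) auto
    then have "cosh \<bar>rate * greedy_state x t a\<bar> \<le> cosh (real t)"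
      by (subst cosh_real_nonneg_le_iff) auto
    then show ?thesis by simp
  qed
  then show "potential (greedy_state x t) \<le> card J * cosh (real t)"
    unfolding potential_def by (intro sum_bounded_above) auto
qed

text \<open>A single summand of the potential is already at least
  \<open>exp (rate * abs (s a)) / 2\<close>. Undoing \<open>rate\<close> costs the factor
  \<open>card Groups\<close>.\<close>

lemma abs_le_of_potential_less:
  assumes "a \<in> J" "potential s < K"
  shows "\<bar>s a\<bar> \<le> card Groups * ln (2 * K)"
proof -
  have n: "0 < card Groups"
    using finite_Groups Groups_ne by (simp add: card_gt_0_iff)
  have "exp \<bar>rate * s a\<bar> \<le> 2 * cosh \<bar>rate * s a\<bar>"
    unfolding cosh_field_def by simp
  also have "cosh \<bar>rate * s a\<bar> \<le> potential s"
    unfolding potential_def cosh_real_abs using assms(1) finite_J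
    by (intro member_le_sum[where f = "\<lambda>a. cosh (rate * s a)"]) auto
  finally have "exp \<bar>rate * s a\<bar> \<le> 2 * K"
    using assms(2) by simp
  then have "\<bar>rate * s a\<bar> \<le> ln (2 * K)"
    by (metis exp_gt_zero ln_exp ln_le_cancel_iff order_less_le_trans)
  then show ?thesis
    using n by (simp add: rate_def abs_mult field_simps)
qed

lemma integrable_potential_greedy:
  assumes "t \<le> T"
  shows "integrable (\<Pi>\<^sub>M s\<in>{1..T}. M) (\<lambda>x. potential (greedy_state x t))"
proof -
  interpret P: prob_space "\<Pi>\<^sub>M s\<in>{1..T}. M"
    by (intro prob_space_PiM) (rule prob_space_axioms)
  have [measurable]: "\<And>a. a \<in> J \<Longrightarrow> (\<lambda>x. greedy_state x t a) \<in> borel_measurable (\<Pi>\<^sub>M s\<in>{1..T}. M)"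
    using assms by (intro measurable_greedy_state)
  have [measurable]: "cosh \<in> borel_measurable (borel :: real measure)"
    by (intro borel_measurable_continuous_onI continuous_intros)
  show ?thesis
    by (rule P.integrable_const_bound[where B = "card J * cosh (real t)"])
      (use potential_greedy_state_bounds[of _ t] in \<open>auto simp: potential_def\<close>)
qed

text \<open>Induction over time: initially every summand is \<open>cosh 0 = 1\<close>, and each step
  adds at most 2 on average once the other points are fixed.\<close>

lemma expected_potential_greedy_le:
  assumes "t \<le> T"
  shows "(\<integral>x. potential (greedy_state x t) \<partial>(\<Pi>\<^sub>M s\<in>{1..T}. M)) \<le> card J + 2 * t"
  using assms
proof (induction t)
  case 0
  interpret P: prob_space "\<Pi>\<^sub>M s\<in>{1..T}. M"
    by (intro prob_space_PiM) (rule prob_space_axioms)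
  show ?case
    by (simp add: potential_def P.prob_space)
next
  case (Suc t)
  define f where "f x = potential (greedy_state x (Suc t)) - potential (greedy_state x t)" for x
  have i: "integrable (\<Pi>\<^sub>M s\<in>{1..T}. M) (\<lambda>x. potential (greedy_state x t))"
      "integrable (\<Pi>\<^sub>M s\<in>{1..T}. M) (\<lambda>x. potential (greedy_state x (Suc t)))"
    using Suc.prems by (intro integrable_potential_greedy; simp)+
  have "(\<integral>x. f x \<partial>(\<Pi>\<^sub>M s\<in>{1..T}. M)) \<le> 2"
  proof (rule expectation_component_le[where t = "Suc t"])
    show "integrable (\<Pi>\<^sub>M s\<in>{1..T}. M) f"
      unfolding f_def using i by auto
    fix x
    \<comment> \<open>The state before step \<open>Suc t\<close> does not see the point that is
      averaged, so the one-step bound applies with this state fixed.\<close>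
    have "greedy_state (x(Suc t := y)) t = greedy_state x t" for y
      by (rule greedy_state_cong) auto
    then have "f (x(Suc t := y)) = (cosh rate - 1) * (\<Sum>a\<in>J. cosh (rate * greedy_state x t a) * \<bar>v a y\<bar>)
        - sinh rate * \<bar>lin (\<lambda>a. sinh (rate * greedy_state x t a)) y\<bar>" for y
      unfolding f_def by (simp add: potential_step)
    then show "(\<integral>y. f (x(Suc t := y)) \<partial>M) \<le> 2"
      using expected_potential_increment_le[of "greedy_state x t"] by presburger
  qed (use Suc.prems in auto)
  moreover have "(\<integral>x. f x \<partial>(\<Pi>\<^sub>M s\<in>{1..T}. M)) = (\<integral>x. potential (greedy_state x (Suc t)) \<partial>(\<Pi>\<^sub>M s\<in>{1..T}. M))
      - (\<integral>x. potential (greedy_state x t) \<partial>(\<Pi>\<^sub>M s\<in>{1..T}. M))"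
    unfolding f_def using i by (rule_tac Bochner_Integration.integral_diff) auto
  ultimately show ?case
    using Suc by simp
qed

subsection \<open>Growth of the quadratic potential\<close>

lemma measurable_signed_count:
  assumes "\<And>t. t \<in> {1..T} \<Longrightarrow> (\<lambda>x. \<epsilon> x t) \<in> borel_measurable (\<Pi>\<^sub>M s\<in>{1..T}. M)" "t \<le> T" "a \<in> J"
  shows "(\<lambda>x. signed_count (\<epsilon> x) x t a) \<in> borel_measurable (\<Pi>\<^sub>M s\<in>{1..T}. M)"
proof -
  have "(\<lambda>x. v a (x s)) \<in> borel_measurable (\<Pi>\<^sub>M s\<in>{1..T}. M)" if "s \<in> {1..T}" for s
    using measurable_compose[OF measurable_component_singleton[OF that] measurable_v[OF assms(3)]] .
  then show ?thesis
    unfolding signed_count_def using assms by (intro borel_measurable_sum borel_measurable_times) auto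
qed

lemma sets_signed_count_bounded:
  assumes "\<And>t. t \<in> {1..T} \<Longrightarrow> (\<lambda>x. \<epsilon> x t) \<in> borel_measurable (\<Pi>\<^sub>M s\<in>{1..T}. M)" "t \<le> T"
  shows "{x \<in> space (\<Pi>\<^sub>M s\<in>{1..T}. M). \<forall>s\<in>{..t}. \<forall>a\<in>J. \<bar>signed_count (\<epsilon> x) x s a\<bar> \<le> B}
    \<in> sets (\<Pi>\<^sub>M s\<in>{1..T}. M)"
proof (intro sets.sets_Collect_finite_All finite_J)
  fix s a assume "s \<in> {..t}" "a \<in> J"
  then have [measurable]: "(\<lambda>x. signed_count (\<epsilon> x) x s a) \<in> borel_measurable (\<Pi>\<^sub>M s\<in>{1..T}. M)"
    using assms by (intro measurable_signed_count[of T]) auto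
  show "{x \<in> space (\<Pi>\<^sub>M s\<in>{1..T}. M). \<bar>signed_count (\<epsilon> x) x s a\<bar> \<le> B} \<in> sets (\<Pi>\<^sub>M s\<in>{1..T}. M)"
    by measurable
qed auto

text \<open>The sum of squared counts, stopped when some count first exceeds \<open>B\<close>, rises
  on average by at least \<open>card Groups / 2\<close> per step before stopping, for any online
  signs. It never exceeds \<open>(B + 1)^2 * card J\<close>. Paths that survive all \<open>T\<close>
  steps thus have the probability stated.\<close>

lemma prob_signed_count_bounded_le:
  fixes \<epsilon> :: "(nat \<Rightarrow> 'y) \<Rightarrow> nat \<Rightarrow> real"
  assumes measurable_sign[measurable]:
      "\<And>t. t \<in> {1..T} \<Longrightarrow> (\<lambda>x. \<epsilon> x t) \<in> borel_measurable (\<Pi>\<^sub>M s\<in>{1..T}. M)"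
    and sign: "\<And>x t. \<bar>\<epsilon> x t\<bar> = 1"
    and online: "\<And>x x' t. \<lbrakk>t \<in> {1..T}; \<And>s. s \<in> {1..t} \<Longrightarrow> x s = x' s\<rbrakk> \<Longrightarrow> \<epsilon> x t = \<epsilon> x' t"
    and B: "0 \<le> B" "4 * B \<le> sqrt (card Groups)"
  shows "measure (\<Pi>\<^sub>M s\<in>{1..T}. M)
      {x \<in> space (\<Pi>\<^sub>M s\<in>{1..T}. M). \<forall>t\<in>{..T}. \<forall>a\<in>J. \<bar>signed_count (\<epsilon> x) x t a\<bar> \<le> B}
    * (real (card Groups) * real T) \<le> 2 * (B + 1)\<^sup>2 * card J"
proof -
  let ?P = "\<Pi>\<^sub>M s\<in>{1..T}. M"
  interpret P: prob_space ?P
    by (intro prob_space_PiM) (rule prob_space_axioms)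
  define n where "n = real (card Groups)"
  define D where "D x t a = signed_count (\<epsilon> x) x t a" for x t a
  \<comment> \<open>Decided by the first \<open>t\<close> points and decreasing in \<open>t\<close>:
    a stopping rule.\<close>
  define alive where "alive x t \<longleftrightarrow> (\<forall>s\<in>{..t}. \<forall>a\<in>J. \<bar>D x s a\<bar> \<le> B)" for x t
  define Phi where "Phi x t = (\<Sum>a\<in>J. (D x t a)\<^sup>2)" for x t
  \<comment> \<open>The shortfall of the growth against \<open>n / 2\<close>, set to 0 after
    stopping. Its mean over the new point is nonpositive.\<close>
  define f where "f t x = (if alive x t then n / 2 - (Phi x (Suc t) - Phi x t) else 0)" for t x

  have D_cong: "D x t a = D x' t a" if "t \<le> T" "\<And>s. s \<in> {1..t} \<Longrightarrow> x s = x' s" for x x' t a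
    unfolding D_def signed_count_def
  proof (rule sum.cong[OF refl])
    fix s assume s: "s \<in> {1..t}"
    have "\<epsilon> x s = \<epsilon> x' s"
      by (rule online) (use s that in auto)
    then show "\<epsilon> x s * v a (x s) = \<epsilon> x' s * v a (x' s)"
      using that(2)[OF s] by simp
  qed
  have D_Suc: "D x (Suc t) a = D x t a + \<epsilon> x (Suc t) * v a (x (Suc t))" for x t a
    by (simp add: D_def signed_count_Suc)
  have D_le: "\<bar>D x t a\<bar> \<le> t" for x t a
    unfolding D_def by (rule abs_signed_count_le) (simp add: sign)
  have Phi_le: "Phi x t \<le> card J * (real T)\<^sup>2" if "t \<le> T" for x t
  proof -
    have "(D x t a)\<^sup>2 \<le> (real T)\<^sup>2" for a
    proof -
      have "\<bar>D x t a\<bar> \<le> real T"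
        using D_le[of x t a] that by linarith
      then have "\<bar>D x t a\<bar>\<^sup>2 \<le> (real T)\<^sup>2"
        by (intro power_mono) auto
      then show ?thesis by simp
    qed
    then show ?thesis
      unfolding Phi_def by (intro sum_bounded_above) auto
  qed
  have Phi_nonneg: "0 \<le> Phi x t" for x t
    unfolding Phi_def by (intro sum_nonneg) simp
  \<comment> \<open>Signs square to 1 and each \<open>v a\<close> squares to its modulus, so only
    the cross term depends on the sign.\<close>
  have Phi_Suc: "Phi x (Suc t) - Phi x t
      = (\<Sum>a\<in>J. \<bar>v a (x (Suc t))\<bar>) + 2 * \<epsilon> x (Suc t) * lin (D x t) (x (Suc t))" for x t
  proof -
    have "(\<epsilon> x (Suc t))\<^sup>2 = 1"
      using sign[of x "Suc t"] by (metis one_power2 power2_abs)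
    then have "(D x (Suc t) a)\<^sup>2 = (D x t a)\<^sup>2 + (\<bar>v a (x (Suc t))\<bar>
        + 2 * \<epsilon> x (Suc t) * (D x t a * v a (x (Suc t))))" for a
      unfolding D_Suc power2_sum power_mult_distrib
      using v_square[of a "x (Suc t)"] by (simp add: power2_eq_square[of "v a _"])
    then show ?thesis
      by (simp add: Phi_def lin_def sum.distrib sum_distrib_left)
  qed

  have [measurable]: "(\<lambda>x. D x t a) \<in> borel_measurable ?P" if "t \<le> T" "a \<in> J" for t a
    unfolding D_def using that measurable_sign by (intro measurable_signed_count)
  have alive_meas: "{x \<in> space ?P. alive x t} \<in> sets ?P" if "t \<le> T" for t
    unfolding alive_def D_def using that measurable_sign by (intro sets_signed_count_bounded)
  have Phi_meas: "(\<lambda>x. Phi x t) \<in> borel_measurable ?P" if "t \<le> T" for t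
    unfolding Phi_def using that by measurable

  have f_int: "integrable ?P (f t)" if "t < T" for t
  proof (rule P.integrable_const_bound[where B = "n / 2 + card J * (real T)\<^sup>2"])
    have "\<bar>f t x\<bar> \<le> n / 2 + card J * (real T)\<^sup>2" for x
    proof -
      have "0 \<le> n" "0 \<le> card J * (real T)\<^sup>2"
        by (auto simp: n_def)
      then show ?thesis
        using Phi_le[of t x] Phi_le[of "Suc t" x] Phi_nonneg[of x t] Phi_nonneg[of x "Suc t"] that
        unfolding f_def by auto
    qed
    then show "AE x in ?P. norm (f t x) \<le> n / 2 + card J * (real T)\<^sup>2"
      by simp
    have [measurable]: "(\<lambda>x. Phi x t) \<in> borel_measurable ?P" "(\<lambda>x. Phi x (Suc t)) \<in> borel_measurable ?P"
      using Phi_meas that by auto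
    have [measurable]: "Measurable.pred ?P (\<lambda>x. alive x t)"
      using alive_meas[of t] that by (simp add: pred_def)
    show "f t \<in> borel_measurable ?P"
      unfolding f_def[abs_def] by measurable
  qed

  have f_nonpos: "(\<integral>x. f t x \<partial>?P) \<le> 0" if "t < T" for t
  proof (rule expectation_component_le[where t = "Suc t"])
    fix x
    have D_upd: "D (x(Suc t := y)) s = D x s" if "s \<le> t" for s y
      using \<open>t < T\<close> that by (intro ext D_cong) auto
    have alive_upd: "alive (x(Suc t := y)) t = alive x t" for y
      unfolding alive_def using D_upd by simp
    show "(\<integral>y. f t (x(Suc t := y)) \<partial>M) \<le> 0"
    proof (cases "alive x t \<and> integrable M (\<lambda>y. f t (x(Suc t := y)))")
      \<comment> \<open>After stopping the integrand is 0; without integrability the integral is 0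
        by convention.\<close>
      case False
      then show ?thesis
        by (cases "alive x t") (auto simp: not_integrable_integral_eq f_def alive_upd)
    next
      case True
      have iv: "integrable M (\<lambda>y. \<Sum>a\<in>J. \<bar>v a y\<bar>)"
        using integrable_v by auto
      have "(\<integral>y. f t (x(Suc t := y)) \<partial>M)
          \<le> (\<integral>y. n / 2 - (\<Sum>a\<in>J. \<bar>v a y\<bar>) + 2 * \<bar>lin (D x t) y\<bar> \<partial>M)"
      proof (rule integral_mono)
        fix y
        \<comment> \<open>The sign may depend on the new point \<open>y\<close>, so the worst sign
          is assumed for every \<open>y\<close>.\<close>
        have "- (\<epsilon> (x(Suc t := y)) (Suc t) * lin (D x t) y) \<le> \<bar>lin (D x t) y\<bar>"
          using abs_ge_minus_self[of "\<epsilon> (x(Suc t := y)) (Suc t) * lin (D x t) y"]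
          by (simp only: abs_mult sign mult_1_left)
        moreover have "f t (x(Suc t := y)) = n / 2
            - ((\<Sum>a\<in>J. \<bar>v a y\<bar>) + 2 * (\<epsilon> (x(Suc t := y)) (Suc t) * lin (D x t) y))"
          unfolding f_def Phi_Suc using True by (simp add: alive_upd D_upd)
        ultimately show "f t (x(Suc t := y)) \<le> n / 2 - (\<Sum>a\<in>J. \<bar>v a y\<bar>) + 2 * \<bar>lin (D x t) y\<bar>"
          by linarith
      qed (use True iv integrable_lin in auto)
      also have "\<dots> = n / 2 - (\<Sum>a\<in>J. w a) + 2 * expectation (\<lambda>y. \<bar>lin (D x t) y\<bar>)"
      proof -
        have "expectation (\<lambda>y. \<Sum>a\<in>J. \<bar>v a y\<bar>) = (\<Sum>a\<in>J. w a)"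
          using integrable_v by (subst Bochner_Integration.integral_sum) (auto simp: expectation_abs_v)
        then show ?thesis
          using iv integrable_lin[of "D x t"] by (simp add: prob_space)
      qed
      also have "\<dots> = - n / 2 + 2 * expectation (\<lambda>y. \<bar>lin (D x t) y\<bar>)"
        by (simp add: sum_w n_def)
      finally have int_le: "(\<integral>y. f t (x(Suc t := y)) \<partial>M)
          \<le> - n / 2 + 2 * expectation (\<lambda>y. \<bar>lin (D x t) y\<bar>)" .
      have "expectation (\<lambda>y. \<bar>lin (D x t) y\<bar>) \<le> sqrt (\<Sum>a\<in>J. (D x t a)\<^sup>2 * w a)"
        by (rule expectation_abs_lin_le)
      also have "\<dots> \<le> sqrt (\<Sum>a\<in>J. B\<^sup>2 * w a)"
      proof (intro real_sqrt_le_mono sum_mono mult_right_mono w_nonneg)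
        fix a assume "a \<in> J"
        then have "\<bar>D x t a\<bar>\<^sup>2 \<le> B\<^sup>2"
          using True unfolding alive_def by (intro power_mono) auto
        then show "(D x t a)\<^sup>2 \<le> B\<^sup>2" by simp
      qed
      also have "\<dots> = B * sqrt n"
        using B by (simp add: sum_distrib_left[symmetric] sum_w n_def real_sqrt_mult)
      finally have "expectation (\<lambda>y. \<bar>lin (D x t) y\<bar>) \<le> B * sqrt n" .
      \<comment> \<open>Here the hypothesis \<open>4 * B <= sqrt n\<close> enters: the gain the
        signs can extract is at most half of the mean growth \<open>n\<close>.\<close>
      moreover have "- n / 2 + 2 * (B * sqrt n) \<le> 0"
      proof -
        have "4 * B * sqrt n \<le> sqrt n * sqrt n"
          using B by (intro mult_right_mono) (auto simp: n_def)
        then show ?thesis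
          by (simp add: n_def)
      qed
      ultimately show ?thesis
        using int_le by linarith
    qed
  qed (use that f_int in auto)

  \<comment> \<open>The stopped increments telescope. The step that ends survival may overshoot
    \<open>B\<close> by at most 1, and afterwards the sum is frozen.\<close>
  have path: "(alive x t \<longrightarrow> (\<Sum>s<t. if alive x s then Phi x (Suc s) - Phi x s else 0) = Phi x t)
      \<and> (\<Sum>s<t. if alive x s then Phi x (Suc s) - Phi x s else 0) \<le> (B + 1)\<^sup>2 * card J" for x t
  proof (induction t)
    case 0
    show ?case by (simp add: Phi_def D_def)
  next
    case (Suc t)
    show ?case
    proof (cases "alive x t")
      case True
      have "(D x (Suc t) a)\<^sup>2 \<le> (B + 1)\<^sup>2" if "a \<in> J" for a
      proof -
        have "\<bar>\<epsilon> x (Suc t) * v a (x (Suc t))\<bar> \<le> 1"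
          by (simp add: abs_mult sign abs_v_le_1)
        moreover have "\<bar>D x t a\<bar> \<le> B"
          using True that unfolding alive_def by simp
        ultimately have "\<bar>D x (Suc t) a\<bar> \<le> B + 1"
          unfolding D_Suc by linarith
        then have "\<bar>D x (Suc t) a\<bar>\<^sup>2 \<le> (B + 1)\<^sup>2"
          by (intro power_mono) auto
        then show ?thesis by simp
      qed
      then have "Phi x (Suc t) \<le> card J * (B + 1)\<^sup>2"
        unfolding Phi_def by (intro sum_bounded_above) auto
      then show ?thesis
        using Suc True by (simp add: mult.commute)
    next
      case False
      then have "\<not> alive x (Suc t)"
        unfolding alive_def by auto
      then show ?thesis
        using Suc False by simp
    qed
  qed

  \<comment> \<open>A surviving path collects \<open>n / 2\<close> at each of the \<open>T\<close>
    steps, while the increments subtracted from this are bounded by \<open>path\<close>.\<close>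
  have "n / 2 * T * indicator {x \<in> space ?P. alive x T} x - (B + 1)\<^sup>2 * card J \<le> (\<Sum>t<T. f t x)" for x
  proof -
    have "n / 2 * T * indicator {x \<in> space ?P. alive x T} x \<le> (\<Sum>t<T. if alive x t then n / 2 else 0)"
    proof (cases "alive x T")
      case True
      then have "alive x t" if "t < T" for t
        using that unfolding alive_def by auto
      then show ?thesis
        by (simp add: n_def indicator_def)
    next
      case False
      then show ?thesis
        by (simp add: n_def sum_nonneg)
    qed
    moreover have "(\<Sum>t<T. f t x) = (\<Sum>t<T. if alive x t then n / 2 else 0)
        - (\<Sum>t<T. if alive x t then Phi x (Suc t) - Phi x t else 0)"
      unfolding sum_subtractf[symmetric] f_def by (intro sum.cong) auto
    ultimately show ?thesis
      using path[of x T] by linarith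
  qed
  moreover have ind: "integrable ?P (\<lambda>x. n / 2 * T * indicator {x \<in> space ?P. alive x T} x)"
    using alive_meas[of T]
    by (intro integrable_mult_right integrable_real_indicator) (simp_all add: P.emeasure_finite less_top[symmetric])
  ultimately have "(\<integral>x. n / 2 * T * indicator {x \<in> space ?P. alive x T} x - (B + 1)\<^sup>2 * card J \<partial>?P)
      \<le> (\<integral>x. (\<Sum>t<T. f t x) \<partial>?P)"
    using f_int
    by (intro integral_mono Bochner_Integration.integrable_diff Bochner_Integration.integrable_sum P.integrable_const) auto
  also have "\<dots> = (\<Sum>t<T. \<integral>x. f t x \<partial>?P)"
    using f_int by (intro Bochner_Integration.integral_sum) auto
  also have "\<dots> \<le> 0"
    using f_nonpos by (intro sum_nonpos) auto
  also have "(\<integral>x. n / 2 * T * indicator {x \<in> space ?P. alive x T} x - (B + 1)\<^sup>2 * card J \<partial>?P)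
      = n / 2 * T * measure ?P {x \<in> space ?P. alive x T} - (B + 1)\<^sup>2 * card J"
    using alive_meas[of T] ind by (subst Bochner_Integration.integral_diff) (auto simp: P.prob_space)
  finally show ?thesis
    unfolding alive_def D_def by (simp add: n_def algebra_simps)
qed

end

subsection \<open>The Haar system of the cube\<close>

abbreviation unit_measure :: "real measure" where
  "unit_measure \<equiv> uniform_measure lborel {0..1}"

definition dyadic_cell :: "nat \<Rightarrow> real \<Rightarrow> int" where
  "dyadic_cell l z = \<lfloor>z * 2 ^ l\<rfloor>"

text \<open>Unnormalised, so that the values are -1, 0 and 1 as a sign system demands; the squared
  norm \<open>1 / 2 ^ l\<close> becomes the weight.\<close>

definition haar :: "nat \<Rightarrow> nat \<Rightarrow> real \<Rightarrow> real" where
  "haar l j z = of_bool (dyadic_cell (Suc l) z = 2 * int j)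
     - of_bool (dyadic_cell (Suc l) z = 2 * int j + 1)"

lemma prob_space_unit_measure: "prob_space unit_measure"
  by (rule prob_space_uniform_measure) auto

lemma dyadic_cell_eq_iff:
  "dyadic_cell l z = int j \<longleftrightarrow> real j / 2 ^ l \<le> z \<and> z < real (Suc j) / 2 ^ l"
  unfolding dyadic_cell_def floor_eq_iff by (simp add: field_simps)

lemma measurable_dyadic_cell[measurable]: "dyadic_cell l \<in> borel \<rightarrow>\<^sub>M count_space UNIV"
  unfolding dyadic_cell_def[abs_def] by measurable

lemma measurable_haar[measurable]: "haar l j \<in> borel_measurable borel"
  unfolding haar_def[abs_def] by measurable

text \<open>Nesting of the levels: dropping the last \<open>k\<close> binary digits leads to the
  enclosing coarser cell.\<close>

lemma dyadic_cell_div: "dyadic_cell l z = dyadic_cell (l + k) z div 2 ^ k"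
proof -
  have "z * 2 ^ l = z * 2 ^ (l + k) / real_of_int (2 ^ k)"
    by (simp add: power_add)
  then have "\<lfloor>z * 2 ^ l\<rfloor> = \<lfloor>z * 2 ^ (l + k) / real_of_int (2 ^ k)\<rfloor>"
    by simp
  also have "\<dots> = \<lfloor>z * 2 ^ (l + k)\<rfloor> div 2 ^ k"
    by (rule floor_divide_real_eq_div) simp
  finally show ?thesis
    by (simp add: dyadic_cell_def)
qed

lemma haar_values: "haar l j z \<in> {-1, 0, 1}"
  by (auto simp: haar_def)

lemma haar_square: "haar l j z * haar l j z = of_bool (dyadic_cell l z = int j)"
proof -
  have "dyadic_cell l z = int j \<longleftrightarrow> dyadic_cell (Suc l) z = 2 * int j \<or> dyadic_cell (Suc l) z = 2 * int j + 1"
    using dyadic_cell_div[of l z 1] unfolding Suc_eq_plus1 power_one_right by linarith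
  then show ?thesis
    by (auto simp: haar_def)
qed

lemma haar_disjoint: "j \<noteq> j' \<Longrightarrow> haar l j z = 0 \<or> haar l j' z = 0"
  by (auto simp: haar_def; presburger)

text \<open>The support lies in one cell of each level up to \<open>l\<close>, so every Haar
  function of a strictly coarser level is constant on it.\<close>

lemma haar_nonzero_imp_cell:
  assumes "haar l j z \<noteq> 0" "m \<le> l"
  shows "dyadic_cell m z = int j div 2 ^ (l - m)"
proof -
  have "haar l j z * haar l j z \<noteq> 0"
    using assms(1) by simp
  then have "dyadic_cell l z = int j"
    by (simp add: haar_square split: if_splits)
  then show ?thesis
    using dyadic_cell_div[of m z "l - m"] assms(2) by simp
qed

lemma integrable_unit_measure:
  assumes "f \<in> borel_measurable borel" "\<And>z. \<bar>f z\<bar> \<le> (C::real)"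
  shows "integrable unit_measure f"
proof -
  interpret U: prob_space unit_measure by (rule prob_space_unit_measure)
  show ?thesis
    by (rule U.integrable_const_bound[where B = C]) (use assms in auto)
qed

lemma dyadic_cell_vimage: "{z. dyadic_cell l z = int j} = {real j / 2 ^ l ..< real (Suc j) / 2 ^ l}"
  by (auto simp: dyadic_cell_eq_iff simp del: of_nat_Suc)

lemma dyadic_interval:
  assumes "j < 2 ^ l"
  shows "is_interval {z. dyadic_cell l z = int j}" "{z. dyadic_cell l z = int j} \<subseteq> {0..1}"
proof -
  show "is_interval {z. dyadic_cell l z = int j}"
    unfolding dyadic_cell_vimage by (rule is_interval_co)
  have "real (Suc j) \<le> 2 ^ l"
    using assms by (metis Suc_leI of_nat_le_iff of_nat_numeral of_nat_power)
  then have "real (Suc j) / 2 ^ l \<le> 1"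
    by (simp add: divide_le_eq del: of_nat_Suc)
  moreover have "0 \<le> real j / 2 ^ l"
    by simp
  ultimately show "{z. dyadic_cell l z = int j} \<subseteq> {0..1}"
    unfolding dyadic_cell_vimage
    by (meson atLeastAtMost_iff atLeastLessThan_iff less_imp_le order_trans subsetI)
qed

lemma integral_dyadic_cell:
  assumes "j < 2 ^ l"
  shows "(\<integral>z. of_bool (dyadic_cell l z = int j) \<partial>unit_measure) = (1 / 2 ^ l :: real)"
proof -
  have "(\<integral>z. of_bool (dyadic_cell l z = int j) \<partial>unit_measure)
      = (\<integral>z. indicator {z. dyadic_cell l z = int j} z \<partial>unit_measure)"
    by (intro Bochner_Integration.integral_cong) (auto simp: indicator_def)
  also have "\<dots> = measure unit_measure {real j / 2 ^ l ..< real (Suc j) / 2 ^ l}"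
    by (simp add: dyadic_cell_vimage)
  also have "\<dots> = measure lborel ({0..1} \<inter> {real j / 2 ^ l ..< real (Suc j) / 2 ^ l})"
    by (subst measure_uniform_measure) auto
  also have "{0..1} \<inter> {real j / 2 ^ l ..< real (Suc j) / 2 ^ l} = {real j / 2 ^ l ..< real (Suc j) / 2 ^ l}"
    using dyadic_interval(2)[OF assms] unfolding dyadic_cell_vimage by (rule Int_absorb1)
  also have "measure lborel \<dots> = real (Suc j) / 2 ^ l - real j / 2 ^ l"
    by (rule measure_lborel_Ico) (simp add: divide_right_mono)
  also have "\<dots> = 1 / 2 ^ l"
    by (simp add: field_simps)
  finally show ?thesis .
qed

lemma integral_haar:
  assumes "j < 2 ^ l"
  shows "(\<integral>z. haar l j z \<partial>unit_measure) = 0"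
proof -
  have i: "integrable unit_measure (\<lambda>z. of_bool (dyadic_cell (Suc l) z = c) :: real)" for c
    by (rule integrable_unit_measure[where C = 1]) auto
  have "(\<integral>z. of_bool (dyadic_cell (Suc l) z = 2 * int j) \<partial>unit_measure) = (1 / 2 ^ Suc l :: real)"
    "(\<integral>z. of_bool (dyadic_cell (Suc l) z = 2 * int j + 1) \<partial>unit_measure) = (1 / 2 ^ Suc l :: real)"
    using integral_dyadic_cell[of "2 * j" "Suc l"] integral_dyadic_cell[of "2 * j + 1" "Suc l"] assms
    by (auto simp: algebra_simps)
  then show ?thesis
    unfolding haar_def using i by (subst Bochner_Integration.integral_diff) auto
qed

lemma integral_haar_haar:
  assumes "j < 2 ^ l" "j' < 2 ^ l'"
  shows "(\<integral>z. haar l j z * haar l' j' z \<partial>unit_measure) = (if l = l' \<and> j = j' then 1 / 2 ^ l else 0)"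
proof -
  have *: "(\<integral>z. haar l j z * haar l' j' z \<partial>unit_measure) = 0" if "l < l'" "j' < 2 ^ l'" for l j l' j'
  proof -
    \<comment> \<open>\<open>c\<close> is the cell of level \<open>Suc l\<close> around the support
      of the finer function, and \<open>r\<close> the value of the coarser function there. The finer
      function has mean zero.\<close>
    define c where "c = int j' div 2 ^ (l' - Suc l)"
    define r :: real where "r = of_bool (c = 2 * int j) - of_bool (c = 2 * int j + 1)"
    have "haar l j z * haar l' j' z = r * haar l' j' z" for z
      using haar_nonzero_imp_cell[of l' j' z "Suc l"] that
      by (cases "haar l' j' z = 0") (auto simp: haar_def[of l j] r_def c_def)
    then have "(\<integral>z. haar l j z * haar l' j' z \<partial>unit_measure) = (\<integral>z. r * haar l' j' z \<partial>unit_measure)"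
      by presburger
    then show ?thesis
      using integral_haar[OF that(2)] by simp
  qed
  consider "l < l'" | "l' < l" | "l = l'" "j = j'" | "l = l'" "j \<noteq> j'"
    by linarith
  then show ?thesis
  proof cases
    case 1
    then show ?thesis using *[of l l' j' j] assms by simp
  next
    case 2
    then show ?thesis using *[of l' l j j'] assms by (simp add: mult.commute)
  next
    case 3
    then show ?thesis using assms by (simp add: haar_square integral_dyadic_cell)
  next
    case 4
    then have "haar l j z * haar l' j' z = 0" for z
      using haar_disjoint[of j j' l z] by auto
    then have "(\<integral>z. haar l j z * haar l' j' z \<partial>unit_measure) = (\<integral>z. 0 \<partial>unit_measure)"
      by presburger
    then show ?thesis using 4 by simp
  qed
qed

section \<open>The Haar functions of all coordinates of the cube\<close>

lemma prob_space_uniform_cube: "prob_space (uniform_cube d)"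
  unfolding uniform_cube_def by (intro prob_space_PiM prob_space_unit_measure)

lemma measurable_cube_component[measurable]:
  "i \<in> {1..d} \<Longrightarrow> (\<lambda>y. y i) \<in> uniform_cube d \<rightarrow>\<^sub>M borel"
  unfolding uniform_cube_def
  using measurable_component_singleton[of i "{1..d}" "\<lambda>_. unit_measure"] by simp

lemma integral_cube_component:
  assumes "i \<in> {1..d}" "f \<in> borel_measurable borel"
  shows "(\<integral>y. f (y i) \<partial>uniform_cube d) = (\<integral>z. (f z :: real) \<partial>unit_measure)"
proof -
  have "distr (uniform_cube d) unit_measure (\<lambda>y. y i) = unit_measure"
    unfolding uniform_cube_def
    by (rule distr_PiM_component) (use assms prob_space_unit_measure in auto)
  then have "(\<integral>z. f z \<partial>unit_measure) = (\<integral>z. f z \<partial>distr (uniform_cube d) unit_measure (\<lambda>y. y i))"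
    by simp
  also have "\<dots> = (\<integral>y. f (y i) \<partial>uniform_cube d)"
    by (rule integral_distr)
      (use assms measurable_cube_component in \<open>auto simp: measurable_def\<close>)
  finally show ?thesis ..
qed

lemma integral_cube_two_components:
  assumes "i \<in> {1..d}" "i' \<in> {1..d}" "i \<noteq> i'"
    and "integrable unit_measure f" "integrable unit_measure g"
  shows "(\<integral>y. f (y i) * g (y i') \<partial>uniform_cube d)
    = (\<integral>z. (f z :: real) \<partial>unit_measure) * (\<integral>z. g z \<partial>unit_measure)"
proof -
  interpret U: prob_space unit_measure by (rule prob_space_unit_measure)
  interpret P: product_sigma_finite "\<lambda>_::nat. unit_measure" ..
  \<comment> \<open>Padding with the constant 1 in the other coordinates brings the integrand into
    product form.\<close>
  define F where "F k = (if k = i then f else if k = i' then g else (\<lambda>_. 1))" for k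
  have two: "(\<Prod>k\<in>{1..d}. h k) = h i * h i'" if "\<And>k. k \<notin> {i, i'} \<Longrightarrow> h k = 1" for h :: "nat \<Rightarrow> real"
  proof -
    have "(\<Prod>k\<in>{1..d}. h k) = (\<Prod>k\<in>{i, i'}. h k)"
      by (rule prod.mono_neutral_right) (use assms that in auto)
    then show ?thesis using assms(3) by simp
  qed
  have "(\<integral>y. f (y i) * g (y i') \<partial>uniform_cube d) = (\<integral>y. (\<Prod>k\<in>{1..d}. F k (y k)) \<partial>uniform_cube d)"
    using assms(3) by (subst two) (auto simp: F_def)
  also have "\<dots> = (\<Prod>k\<in>{1..d}. integral\<^sup>L unit_measure (F k))"
    unfolding uniform_cube_def
    by (rule P.product_integral_prod) (use assms in \<open>auto simp: F_def\<close>)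
  also have "\<dots> = (\<integral>z. f z \<partial>unit_measure) * (\<integral>z. g z \<partial>unit_measure)"
    using assms(3) by (subst two) (auto simp: F_def U.prob_space[simplified])
  finally show ?thesis .
qed

text \<open>The index \<open>None\<close> stands for the constant function, which must not be repeated for every coordinate.\<close>

definition haar_index :: "nat \<Rightarrow> nat \<Rightarrow> (nat \<times> nat \<times> nat) option set" where
  "haar_index d L = insert None (Some ` (SIGMA i:{1..d}. SIGMA l:{..<L}. {..<2 ^ l}))"

definition haar_groups :: "nat \<Rightarrow> nat \<Rightarrow> (nat \<times> nat) option set" where
  "haar_groups d L = insert None (Some ` ({1..d} \<times> {..<L}))"

definition haar_group :: "(nat \<times> nat \<times> nat) option \<Rightarrow> (nat \<times> nat) option" where
  "haar_group = map_option (\<lambda>(i, l, j). (i, l))"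

text \<open>The constant function appears as the indicator of \<open>[0,1)\<close> in the first
  coordinate. It equals 1 almost surely, and its signed sum is the discrepancy of an interval for
  every input.\<close>

definition cube_haar :: "(nat \<times> nat \<times> nat) option \<Rightarrow> (nat \<Rightarrow> real) \<Rightarrow> real" where
  "cube_haar a y = (case a of None \<Rightarrow> of_bool (dyadic_cell 0 (y 1) = 0)
     | Some (i, l, j) \<Rightarrow> haar l j (y i))"

definition haar_weight :: "(nat \<times> nat \<times> nat) option \<Rightarrow> real" where
  "haar_weight a = (case a of None \<Rightarrow> 1 | Some (i, l, j) \<Rightarrow> 1 / 2 ^ l)"

lemma finite_haar_index: "finite (haar_index d L)"
  unfolding haar_index_def by simp

lemma card_haar_groups: "card (haar_groups d L) = d * L + 1"
  unfolding haar_groups_def by (subst card_insert_disjoint) (auto simp: card_image One_nat_def)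

text \<open>The geometric sum leaves \<open>d * (2 ^ L - 1) + 1\<close>, as all coordinates share
  one constant function.\<close>

lemma card_haar_index: "1 \<le> d \<Longrightarrow> card (haar_index d L) \<le> d * 2 ^ L"
proof -
  assume "1 \<le> d"
  have "(\<Sum>l<L. 2 ^ l :: nat) + 1 = 2 ^ L"
    by (induction L) auto
  then have "d * (\<Sum>l<L. 2 ^ l) + d = d * 2 ^ L"
    by (metis add_mult_distrib2 mult.right_neutral)
  moreover have "card (haar_index d L) = d * (\<Sum>l<L. 2 ^ l) + 1"
    unfolding haar_index_def by (subst card_insert_disjoint) (auto simp: card_image One_nat_def)
  ultimately show ?thesis
    using \<open>1 \<le> d\<close> by linarith
qed

text \<open>Different coordinates are independent and Haar functions have mean zero; within one
  coordinate the one-dimensional orthogonality applies.\<close>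

lemma integral_cube_haar_haar:
  assumes "1 \<le> d" "a \<in> haar_index d L" "b \<in> haar_index d L"
  shows "(\<integral>y. cube_haar a y * cube_haar b y \<partial>uniform_cube d) = (if a = b then haar_weight a else 0)"
proof -
  have one: "1 \<in> {1..d}" using assms by simp
  have i0: "integrable unit_measure (\<lambda>z. of_bool (dyadic_cell 0 z = 0) :: real)"
    by (rule integrable_unit_measure[where C = 1]) auto
  have ih: "integrable unit_measure (haar l j)" for l j
    by (rule integrable_unit_measure[where C = 1]) (auto simp: haar_def)
  have None_Some: "(\<integral>y. cube_haar None y * cube_haar (Some (i, l, j)) y \<partial>uniform_cube d) = 0"
    if "i \<in> {1..d}" "j < 2 ^ l" for i l j
  proof (cases "i = 1")
    case True
    \<comment> \<open>In coordinate 1 there is no independence, but the Haar function is supported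
      in \<open>[0,1)\<close>, where the constant is 1.\<close>
    have "of_bool (dyadic_cell 0 z = 0) * haar l j z = haar l j z" for z
      using haar_nonzero_imp_cell[of l j z 0] that(2)
      by (cases "haar l j z = 0") (auto simp: zdiv_eq_0_iff)
    then have "(\<integral>y. cube_haar None y * cube_haar (Some (i, l, j)) y \<partial>uniform_cube d)
        = (\<integral>y. haar l j (y 1) \<partial>uniform_cube d)"
      unfolding cube_haar_def True option.case prod.case by presburger
    then show ?thesis
      using one that(2) by (simp add: integral_cube_component integral_haar)
  next
    case False
    then show ?thesis
      using that one integral_cube_two_components[OF one that(1) _ i0 ih[of l j]]
      by (simp add: cube_haar_def integral_haar)
  qed
  have Some_Some: "(\<integral>y. cube_haar (Some (i, l, j)) y * cube_haar (Some (i', l', j')) y \<partial>uniform_cube d)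
      = (if i = i' \<and> l = l' \<and> j = j' then 1 / 2 ^ l else 0)"
    if "i \<in> {1..d}" "j < 2 ^ l" "i' \<in> {1..d}" "j' < 2 ^ l'" for i l j i' l' j'
  proof (cases "i = i'")
    case True
    then show ?thesis
      using integral_cube_component[OF that(1), of "\<lambda>z. haar l j z * haar l' j' z"] that
      by (simp add: cube_haar_def integral_haar_haar)
  next
    case False
    then show ?thesis
      using integral_cube_two_components[OF that(1,3) False ih[of l j] ih[of l' j']] that
      by (simp add: cube_haar_def integral_haar)
  qed
  have None_None: "(\<integral>y. cube_haar None y * cube_haar None y \<partial>uniform_cube d) = 1"
  proof -
    have "(\<integral>y. cube_haar None y * cube_haar None y \<partial>uniform_cube d)
        = (\<integral>y. of_bool (dyadic_cell 0 (y 1) = 0) \<partial>uniform_cube d)"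
      by (intro Bochner_Integration.integral_cong) (auto simp: cube_haar_def)
    then show ?thesis
      using integral_cube_component[OF one, of "\<lambda>z. of_bool (dyadic_cell 0 z = 0)"]
        integral_dyadic_cell[of 0 0] by simp
  qed
  show ?thesis
  proof (cases a)
    case None
    show ?thesis
    proof (cases b)
      case None
      then show ?thesis using \<open>a = None\<close> None_None by (simp add: haar_weight_def)
    next
      case (Some p)
      then show ?thesis using \<open>a = None\<close> None_Some assms(3) by (cases p) (auto simp: haar_index_def)
    qed
  next
    case (Some p)
    show ?thesis
    proof (cases b)
      case None
      then show ?thesis using \<open>a = Some p\<close> None_Some assms(2)
        by (cases p) (auto simp: haar_index_def mult.commute[of _ "cube_haar None _"])
    next
      case (Some q)
      then show ?thesis using \<open>a = Some p\<close> Some_Some assms(2,3)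
        by (cases p; cases q) (auto simp: haar_index_def haar_weight_def)
    qed
  qed
qed

lemma sign_system_haar:
  assumes "1 \<le> d"
  shows "sign_system (uniform_cube d) (haar_index d L) (haar_groups d L) haar_group cube_haar haar_weight"
proof -
  interpret prob_space "uniform_cube d" by (rule prob_space_uniform_cube)
  show ?thesis
  proof
    show "finite (haar_index d L)" "finite (haar_groups d L)" "haar_groups d L \<noteq> {}"
      by (simp_all add: finite_haar_index haar_groups_def)
    show "haar_group a \<in> haar_groups d L" if "a \<in> haar_index d L" for a
      using that by (auto simp: haar_index_def haar_groups_def haar_group_def)
    show "cube_haar a \<in> borel_measurable (uniform_cube d)" if "a \<in> haar_index d L" for a
    proof (cases a)
      case None
      have [measurable]: "(\<lambda>y. y 1) \<in> uniform_cube d \<rightarrow>\<^sub>M borel"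
        using assms by (intro measurable_cube_component) auto
      show ?thesis
        unfolding None cube_haar_def by simp
    next
      case (Some p)
      obtain i l j where p: "p = (i, l, j)" by (cases p)
      have [measurable]: "(\<lambda>y. y i) \<in> uniform_cube d \<rightarrow>\<^sub>M borel"
        using that Some p by (intro measurable_cube_component) (auto simp: haar_index_def)
      show ?thesis
        unfolding Some p cube_haar_def by simp
    qed
    show "cube_haar a y \<in> {-1, 0, 1}" for a y
      using haar_values by (auto simp: cube_haar_def split: option.split)
    show "cube_haar a y = 0 \<or> cube_haar b y = 0"
      if "a \<in> haar_index d L" "b \<in> haar_index d L" "a \<noteq> b" "haar_group a = haar_group b" for a b y
      using that haar_disjoint
      by (cases a; cases b) (force simp: haar_group_def cube_haar_def haar_index_def)+
    show "expectation (\<lambda>y. cube_haar a y * cube_haar b y) = (if a = b then haar_weight a else 0)"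
      if "a \<in> haar_index d L" "b \<in> haar_index d L" for a b
      using integral_cube_haar_haar[OF assms that] .
    show "(\<Sum>a\<in>{a \<in> haar_index d L. haar_group a = \<gamma>}. haar_weight a) = 1" if "\<gamma> \<in> haar_groups d L" for \<gamma>
    proof (cases \<gamma>)
      case None
      have "{a \<in> haar_index d L. haar_group a = \<gamma>} = {None}"
        by (auto simp: haar_index_def haar_group_def None)
      then show ?thesis by (simp add: haar_weight_def)
    next
      case (Some p)
      obtain i l where p: "p = (i, l)" by (cases p)
      have "{a \<in> haar_index d L. haar_group a = \<gamma>} = (\<lambda>j. Some (i, l, j)) ` {..<2 ^ l}"
        using that by (auto simp: haar_index_def haar_groups_def haar_group_def Some p)
      moreover have "inj_on (\<lambda>j. Some (i, l, j)) {..<2 ^ l :: nat}"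
        by (auto simp: inj_on_def)
      ultimately show ?thesis
        by (simp add: sum.reindex haar_weight_def)
    qed
  qed
qed

subsection \<open>Reduction to intervals spanned by two points\<close>

text \<open>The endpoints are the extreme points in \<open>I\<close> over the whole horizon, so one
  pair serves all times. Uncountably many intervals are thereby replaced by finitely many pairs of
  indices.\<close>

lemma interval_spanned_by_points:
  assumes "is_interval I" "I \<subseteq> {0..1}" "s \<in> {1..T}" "x s i \<in> (I :: real set)"
  obtains u v where "u \<in> {1..T}" "v \<in> {1..T}" "0 \<le> x u i" "x v i \<le> 1"
    "\<And>t. t \<in> {1..T} \<Longrightarrow> disc \<epsilon> x i t I = disc \<epsilon> x i t {x u i..x v i}"
proof -
  define V where "V = (\<lambda>s. x s i) ` {s \<in> {1..T}. x s i \<in> I}"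
  have V: "finite V" "V \<noteq> {}"
    using assms by (auto simp: V_def)
  obtain u where u: "u \<in> {1..T}" "x u i \<in> I" "x u i = Min V"
    using Min_in[OF V] by (auto simp: V_def)
  obtain v where v: "v \<in> {1..T}" "x v i \<in> I" "x v i = Max V"
    using Max_in[OF V] by (auto simp: V_def)
  have "x s i \<in> I \<longleftrightarrow> x s i \<in> {x u i..x v i}" if "s \<in> {1..T}" for s
  proof
    assume "x s i \<in> I"
    then have "x s i \<in> V"
      using that by (auto simp: V_def)
    then show "x s i \<in> {x u i..x v i}"
      using V by (simp add: u(3) v(3))
  next
    assume "x s i \<in> {x u i..x v i}"
    then show "x s i \<in> I"
      using mem_is_interval_1_I[OF assms(1) u(2) v(2)] by simp
  qed
  then have "disc \<epsilon> x i t I = disc \<epsilon> x i t {x u i..x v i}" if "t \<in> {1..T}" for t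
    unfolding disc_def using that by (intro arg_cong[where f = abs] sum.cong) (auto simp: indicator_def)
  moreover have "0 \<le> x u i" "x v i \<le> 1"
    using assms(2) u v by auto
  ultimately show ?thesis
    using that u v by blast
qed

lemma disc_eq_0:
  assumes "\<And>s. s \<in> {1..T} \<Longrightarrow> x s i \<notin> (I :: real set)" "t \<le> T"
  shows "disc \<epsilon> x i t I = 0"
  unfolding disc_def using assms by (auto intro!: sum.neutral)

text \<open>Makes the event a finite combination of conditions on pairs of points, hence measurable.
  \<open>0 <= B\<close> takes care of intervals without points.\<close>

lemma all_intervals_disc_le_iff:
  assumes "0 \<le> B" "1 \<le> T"
  shows "(\<forall>I. is_interval I \<and> I \<subseteq> {0..1} \<longrightarrow> (MAX t\<in>{1..T}. disc \<epsilon> x i t I) \<le> B) \<longleftrightarrow>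
    (\<forall>u\<in>{1..T}. \<forall>v\<in>{1..T}. 0 \<le> x u i \<and> x v i \<le> 1 \<longrightarrow> (\<forall>t\<in>{1..T}. disc \<epsilon> x i t {x u i..x v i} \<le> B))"
    (is "?L \<longleftrightarrow> ?R")
proof -
  have max_le: "(MAX t\<in>{1..T}. disc \<epsilon> x i t I) \<le> B \<longleftrightarrow> (\<forall>t\<in>{1..T}. disc \<epsilon> x i t I \<le> B)" for I
    using assms(2) by (subst Max_le_iff) auto
  show ?thesis
    unfolding max_le
  proof
    assume L: "\<forall>I. is_interval I \<and> I \<subseteq> {0..1} \<longrightarrow> (\<forall>t\<in>{1..T}. disc \<epsilon> x i t I \<le> B)"
    show ?R
    proof (intro ballI impI)
      fix u v t assume a: "0 \<le> x u i \<and> x v i \<le> 1" "t \<in> {1..T}"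
      then have "{x u i..x v i} \<subseteq> {0..1}"
        by auto
      then show "disc \<epsilon> x i t {x u i..x v i} \<le> B"
        using L a(2) is_interval_cc by blast
    qed
  next
    assume R: ?R
    show "\<forall>I. is_interval I \<and> I \<subseteq> {0..1} \<longrightarrow> (\<forall>t\<in>{1..T}. disc \<epsilon> x i t I \<le> B)"
    proof (intro allI ballI impI)
      fix I :: "real set" and t assume I: "is_interval I \<and> I \<subseteq> {0..1}" and t: "t \<in> {1..T}"
      show "disc \<epsilon> x i t I \<le> B"
      proof (cases "\<exists>s\<in>{1..T}. x s i \<in> I")
        case True
        then obtain s where "s \<in> {1..T}" "x s i \<in> I" by blast
        then obtain u v where "u \<in> {1..T}" "v \<in> {1..T}" "0 \<le> x u i" "x v i \<le> 1"
            "disc \<epsilon> x i t I = disc \<epsilon> x i t {x u i..x v i}"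
          using interval_spanned_by_points[of I s T x i \<epsilon>] I t by metis
        then show ?thesis
          using R t by auto
      next
        case False
        then show ?thesis
          using disc_eq_0[of T x i I t \<epsilon>] t assms(1) by auto
      qed
    qed
  qed
qed

text \<open>\<open>0 < B\<close> forces the interval to contain a point. At \<open>B = 0\<close> the
  left side holds always, but the right side fails if no point qualifies as an endpoint.\<close>

lemma ex_interval_disc_ge_iff:
  assumes "0 < B" "1 \<le> T"
  shows "(\<exists>I. is_interval I \<and> I \<subseteq> {0..1} \<and> (MAX t\<in>{1..T}. disc \<epsilon> x i t I) \<ge> B) \<longleftrightarrow>
    (\<exists>u\<in>{1..T}. \<exists>v\<in>{1..T}. 0 \<le> x u i \<and> x v i \<le> 1 \<and> (\<exists>t\<in>{1..T}. disc \<epsilon> x i t {x u i..x v i} \<ge> B))"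
    (is "?L \<longleftrightarrow> ?R")
proof -
  have le_max: "B \<le> (MAX t\<in>{1..T}. disc \<epsilon> x i t I) \<longleftrightarrow> (\<exists>t\<in>{1..T}. B \<le> disc \<epsilon> x i t I)" for I
    using assms(2) by (subst Max_ge_iff) auto
  show ?thesis
    unfolding le_max
  proof
    assume "\<exists>I. is_interval I \<and> I \<subseteq> {0..1} \<and> (\<exists>t\<in>{1..T}. B \<le> disc \<epsilon> x i t I)"
    then obtain I t where I: "is_interval I" "I \<subseteq> {0..1}" and t: "t \<in> {1..T}" "B \<le> disc \<epsilon> x i t I"
      by blast
    have "\<exists>s\<in>{1..T}. x s i \<in> I"
      using disc_eq_0[of T x i I t \<epsilon>] t assms(1) by fastforce
    then obtain s where "s \<in> {1..T}" "x s i \<in> I" by blast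
    then obtain u v where "u \<in> {1..T}" "v \<in> {1..T}" "0 \<le> x u i" "x v i \<le> 1"
        "disc \<epsilon> x i t I = disc \<epsilon> x i t {x u i..x v i}"
      using interval_spanned_by_points[of I s T x i \<epsilon>] I t by metis
    then show ?R
      using t by metis
  next
    assume ?R
    then obtain u v t where uv: "0 \<le> x u i" "x v i \<le> 1" "t \<in> {1..T}" "disc \<epsilon> x i t {x u i..x v i} \<ge> B"
      by blast
    then have "{x u i..x v i} \<subseteq> {0..1}"
      by auto
    then show "\<exists>I. is_interval I \<and> I \<subseteq> {0..1} \<and> (\<exists>t\<in>{1..T}. B \<le> disc \<epsilon> x i t I)"
      using uv is_interval_cc by blast
  qed
qed

section \<open>Measurability of the discrepancy events\<close>

lemma measurable_disc:
  assumes [measurable]: "\<And>s. s \<in> {1..T} \<Longrightarrow> (\<lambda>\<omega>. \<epsilon> \<omega> s) \<in> borel_measurable N"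
    and [measurable]: "\<And>s. s \<in> {1..T} \<Longrightarrow> (\<lambda>\<omega>. x \<omega> s i) \<in> borel_measurable N"
    and "u \<in> {1..T}" "v \<in> {1..T}" "t \<in> {1..T}"
  shows "(\<lambda>\<omega>. disc (\<epsilon> \<omega>) (x \<omega>) i t {x \<omega> u i..x \<omega> v i}) \<in> borel_measurable N"
proof -
  have [measurable]: "(\<lambda>\<omega>. x \<omega> u i) \<in> borel_measurable N" "(\<lambda>\<omega>. x \<omega> v i) \<in> borel_measurable N"
    using assms by auto
  have "(\<lambda>\<omega>. \<epsilon> \<omega> s * indicator {x \<omega> u i..x \<omega> v i} (x \<omega> s i)) \<in> borel_measurable N" if "s \<in> {1..t}" for s
  proof -
    have [measurable]: "(\<lambda>\<omega>. x \<omega> s i) \<in> borel_measurable N" "(\<lambda>\<omega>. \<epsilon> \<omega> s) \<in> borel_measurable N"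
      using assms that by auto
    show ?thesis
      unfolding indicator_def atLeastAtMost_iff by measurable
  qed
  then show ?thesis
    unfolding disc_def by (intro borel_measurable_abs borel_measurable_sum)
qed

lemma sets_all_intervals_disc_le:
  assumes "\<And>s. s \<in> {1..T} \<Longrightarrow> (\<lambda>\<omega>. \<epsilon> \<omega> s) \<in> borel_measurable N"
    and x: "\<And>s i. s \<in> {1..T} \<Longrightarrow> i \<in> {1..d} \<Longrightarrow> (\<lambda>\<omega>. x \<omega> s i) \<in> borel_measurable N"
    and "0 \<le> B" "1 \<le> T"
  shows "{\<omega> \<in> space N. \<forall>i\<in>{1..d}. \<forall>I. is_interval I \<and> I \<subseteq> {0..1} \<longrightarrow>
      (MAX t\<in>{1..T}. disc (\<epsilon> \<omega>) (x \<omega>) i t I) \<le> B} \<in> sets N"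
  unfolding all_intervals_disc_le_iff[OF assms(3,4)]
proof (intro sets.sets_Collect_finite_All)
  fix i u v assume "i \<in> {1..d}" "u \<in> {1..T}" "v \<in> {1..T}"
  then have [measurable]: "(\<lambda>\<omega>. x \<omega> u i) \<in> borel_measurable N" "(\<lambda>\<omega>. x \<omega> v i) \<in> borel_measurable N"
      "\<And>t. t \<in> {1..T} \<Longrightarrow> (\<lambda>\<omega>. disc (\<epsilon> \<omega>) (x \<omega>) i t {x \<omega> u i..x \<omega> v i}) \<in> borel_measurable N"
    using measurable_disc[of T \<epsilon> N x i] assms by auto
  show "{\<omega> \<in> space N. 0 \<le> x \<omega> u i \<and> x \<omega> v i \<le> 1 \<longrightarrow>
      (\<forall>t\<in>{1..T}. disc (\<epsilon> \<omega>) (x \<omega>) i t {x \<omega> u i..x \<omega> v i} \<le> B)} \<in> sets N"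
    by measurable
qed auto

lemma sets_ex_interval_disc_ge:
  assumes "\<And>s. s \<in> {1..T} \<Longrightarrow> (\<lambda>\<omega>. \<epsilon> \<omega> s) \<in> borel_measurable N"
    and x: "\<And>s i. s \<in> {1..T} \<Longrightarrow> i \<in> {1..d} \<Longrightarrow> (\<lambda>\<omega>. x \<omega> s i) \<in> borel_measurable N"
    and "0 < B" "1 \<le> T"
  shows "{\<omega> \<in> space N. \<exists>i\<in>{1..d}. \<exists>I. is_interval I \<and> I \<subseteq> {0..1} \<and>
      (MAX t\<in>{1..T}. disc (\<epsilon> \<omega>) (x \<omega>) i t I) \<ge> B} \<in> sets N"
  unfolding ex_interval_disc_ge_iff[OF assms(3,4)]
proof (intro sets.sets_Collect_finite_Ex)
  fix i u v assume "i \<in> {1..d}" "u \<in> {1..T}" "v \<in> {1..T}"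
  then have [measurable]: "(\<lambda>\<omega>. x \<omega> u i) \<in> borel_measurable N" "(\<lambda>\<omega>. x \<omega> v i) \<in> borel_measurable N"
      "\<And>t. t \<in> {1..T} \<Longrightarrow> (\<lambda>\<omega>. disc (\<epsilon> \<omega>) (x \<omega>) i t {x \<omega> u i..x \<omega> v i}) \<in> borel_measurable N"
    using measurable_disc[of T \<epsilon> N x i] assms by auto
  show "{\<omega> \<in> space N. 0 \<le> x \<omega> u i \<and> x \<omega> v i \<le> 1 \<and>
      (\<exists>t\<in>{1..T}. B \<le> disc (\<epsilon> \<omega>) (x \<omega>) i t {x \<omega> u i..x \<omega> v i})} \<in> sets N"
    by measurable
qed auto

subsection \<open>Interval discrepancy from Haar coefficients\<close>

lemma dyadic_cell_even: "dyadic_cell (Suc l) z < 2 * q \<longleftrightarrow> dyadic_cell l z < q"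
  using dyadic_cell_div[of l z 1] unfolding Suc_eq_plus1 power_one_right by linarith

text \<open>An odd cut of level \<open>Suc l\<close> bisects cell \<open>m\<close> of level
  \<open>l\<close>. It is the average of the two surrounding cuts of level \<open>l\<close>,
  corrected by half a Haar function.\<close>

lemma dyadic_prefix_odd:
  "2 * of_bool (dyadic_cell (Suc l) z < 2 * int m + 1)
    = of_bool (dyadic_cell l z < int m) + of_bool (dyadic_cell l z < int m + 1) + haar l m z"
proof -
  have "dyadic_cell l z < int m \<longleftrightarrow> dyadic_cell (Suc l) z < 2 * int m"
      "dyadic_cell l z < int m + 1 \<longleftrightarrow> dyadic_cell (Suc l) z < 2 * int m + 2"
    using dyadic_cell_even[of l z "int m"] dyadic_cell_even[of l z "int m + 1"] by auto
  then show ?thesis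
    by (auto simp: haar_def)
qed

text \<open>Induction over levels: an even cut is already a cut of the previous level, and an odd
  one averages two of them and adds at most \<open>M / 2\<close>. The initial 1 pays for the
  constant function.\<close>

lemma dyadic_prefix_bound:
  fixes \<epsilon> z :: "nat \<Rightarrow> real"
  assumes z: "\<And>s. s \<in> S \<Longrightarrow> 0 \<le> z s"
    and const: "\<bar>\<Sum>s\<in>S. \<epsilon> s * of_bool (dyadic_cell 0 (z s) = 0)\<bar> \<le> M"
    and haar: "\<And>l j. l < L \<Longrightarrow> j < 2 ^ l \<Longrightarrow> \<bar>\<Sum>s\<in>S. \<epsilon> s * haar l j (z s)\<bar> \<le> M"
    and "l \<le> L" "q \<le> 2 ^ l"
  shows "\<bar>\<Sum>s\<in>S. \<epsilon> s * of_bool (dyadic_cell l (z s) < int q)\<bar> \<le> M * (1 + l / 2)"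
  using assms(4,5)
proof (induction l arbitrary: q)
  case 0
  have nonneg: "0 \<le> dyadic_cell 0 (z s)" if "s \<in> S" for s
    using z[OF that] by (simp add: dyadic_cell_def)
  have "q = 0 \<or> q = 1"
    using 0 by auto
  then show ?case
  proof
    assume "q = 0"
    have "(\<Sum>s\<in>S. \<epsilon> s * of_bool (dyadic_cell 0 (z s) < int q)) = 0"
      using nonneg \<open>q = 0\<close> by (intro sum.neutral) (auto simp: not_less)
    then show ?thesis using const by simp
  next
    assume "q = 1"
    have "(\<Sum>s\<in>S. \<epsilon> s * of_bool (dyadic_cell 0 (z s) < int q)) = (\<Sum>s\<in>S. \<epsilon> s * of_bool (dyadic_cell 0 (z s) = 0))"
      using nonneg \<open>q = 1\<close> by (intro sum.cong refl) (force simp: of_bool_def)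
    then show ?thesis using const by simp
  qed
next
  case (Suc l)
  have "0 \<le> M"
    using const by linarith
  define F where "F l q = (\<Sum>s\<in>S. \<epsilon> s * of_bool (dyadic_cell l (z s) < int q))" for l q
  have IH: "\<bar>F l q\<bar> \<le> M * (1 + l / 2)" if "q \<le> 2 ^ l" for q
    unfolding F_def using Suc.IH[of q] Suc.prems(1) that by simp
  obtain m where "q = 2 * m \<or> q = 2 * m + 1"
    using oddE by blast
  then have "\<bar>F (Suc l) q\<bar> \<le> M * (1 + Suc l / 2)"
  proof
    assume q: "q = 2 * m"
    have "F (Suc l) q = F l m"
      unfolding F_def q using dyadic_cell_even[of l _ "int m"] by simp
    also have "\<bar>\<dots>\<bar> \<le> M * (1 + l / 2)"
      using IH[of m] Suc.prems(2) q by simp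
    also have "\<dots> \<le> M * (1 + Suc l / 2)"
      using \<open>0 \<le> M\<close> by (intro mult_left_mono) auto
    finally show ?thesis .
  next
    assume q: "q = 2 * m + 1"
    then have m: "m < 2 ^ l"
      using Suc.prems(2) by simp
    have "2 * F (Suc l) q = (\<Sum>s\<in>S. \<epsilon> s * (2 * of_bool (dyadic_cell (Suc l) (z s) < 2 * int m + 1)))"
      unfolding F_def q by (simp add: sum_distrib_left algebra_simps)
    also have "\<dots> = F l m + F l (m + 1) + (\<Sum>s\<in>S. \<epsilon> s * haar l m (z s))"
      unfolding dyadic_prefix_odd F_def by (simp add: distrib_left sum.distrib)
    finally have "2 * \<bar>F (Suc l) q\<bar> \<le> \<bar>F l m\<bar> + \<bar>F l (m + 1)\<bar> + \<bar>\<Sum>s\<in>S. \<epsilon> s * haar l m (z s)\<bar>"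
      by linarith
    also have "\<dots> \<le> M * (1 + l / 2) + M * (1 + l / 2) + M"
      using m Suc.prems(1) by (intro add_mono IH haar) auto
    finally show ?thesis
      by (simp add: field_simps)
  qed
  then show ?case
    by (simp only: F_def)
qed

text \<open>The interval is approximated by a difference of two dyadic prefixes; the error is
  confined to the cells of the two endpoints.\<close>

lemma interval_sum_bound:
  fixes \<epsilon> z :: "nat \<Rightarrow> real"
  assumes "finite S" and z: "\<And>s. s \<in> S \<Longrightarrow> 0 \<le> z s \<and> z s < 1"
    and \<epsilon>: "\<And>s. s \<in> S \<Longrightarrow> \<bar>\<epsilon> s\<bar> \<le> 1"
    and prefix: "\<And>q. q \<le> 2 ^ L \<Longrightarrow> \<bar>\<Sum>s\<in>S. \<epsilon> s * of_bool (dyadic_cell L (z s) < int q)\<bar> \<le> K"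
    and occupancy: "\<And>c. c < 2 ^ L \<Longrightarrow> card {s \<in> S. dyadic_cell L (z s) = int c} \<le> m"
    and a: "0 \<le> a" "a < 1" and b: "0 \<le> b" "b < 1"
  shows "\<bar>\<Sum>s\<in>S. \<epsilon> s * indicator {a..b} (z s)\<bar> \<le> 2 * K + 2 * real m"
proof (cases "a \<le> b")
  case False
  have "0 \<le> K"
    using prefix[of 0] by simp
  with False show ?thesis by simp
next
  case True
  have cell: "0 \<le> dyadic_cell L r" "dyadic_cell L r < 2 ^ L" if "0 \<le> r" "r < 1" for r
    using that by (auto simp: dyadic_cell_def floor_less_iff)
  define p q where "p = nat (dyadic_cell L a)" and "q = nat (dyadic_cell L b)"
  have p: "dyadic_cell L a = int p" "p < 2 ^ L" and q: "dyadic_cell L b = int q" "q < 2 ^ L"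
    using cell[OF a] cell[OF b] by (auto simp: p_def q_def nat_less_iff)
  have mono: "dyadic_cell L r \<le> dyadic_cell L r'" if "r \<le> r'" for r r'
    unfolding dyadic_cell_def using that by (intro floor_mono mult_right_mono) auto
  \<comment> \<open>The prefix difference keeps the cells strictly between \<open>p\<close> and
    \<open>q\<close>. For \<open>p = q\<close> it is -1 on that cell and the error may be 2, which
    the bound allows by counting the cell twice.\<close>
  define e where "e r = indicator {a..b} r
      - (of_bool (dyadic_cell L r < int q) - of_bool (dyadic_cell L r < int (p + 1)) :: real)" for r
  have e: "\<bar>e r\<bar> \<le> of_bool (dyadic_cell L r = int p) + of_bool (dyadic_cell L r = int q)" for r
  proof -
    have "dyadic_cell L r \<le> p" if "r < a"
      using mono[of r a] that p by simp
    moreover have "q \<le> dyadic_cell L r" if "b < r"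
      using mono[of b r] that q by simp
    moreover have "p \<le> dyadic_cell L r" "dyadic_cell L r \<le> q" if "a \<le> r" "r \<le> b"
      using mono[of a r] mono[of r b] that p q by auto
    moreover have "p \<le> q"
      using mono[OF True] p q by simp
    ultimately show ?thesis
      unfolding e_def indicator_def by (cases "r < a"; cases "b < r") (auto simp: of_bool_def)
  qed
  have "(\<Sum>s\<in>S. \<epsilon> s * indicator {a..b} (z s))
      = (\<Sum>s\<in>S. \<epsilon> s * of_bool (dyadic_cell L (z s) < int q))
        - (\<Sum>s\<in>S. \<epsilon> s * of_bool (dyadic_cell L (z s) < int (p + 1))) + (\<Sum>s\<in>S. \<epsilon> s * e (z s))"
    unfolding sum.distrib[symmetric] sum_subtractf[symmetric] e_def
    by (intro sum.cong refl) (simp add: algebra_simps)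
  moreover have "\<bar>\<Sum>s\<in>S. \<epsilon> s * of_bool (dyadic_cell L (z s) < int q)\<bar> \<le> K"
    using q by (intro prefix) auto
  moreover have "\<bar>\<Sum>s\<in>S. \<epsilon> s * of_bool (dyadic_cell L (z s) < int (p + 1))\<bar> \<le> K"
    using p by (intro prefix) auto
  moreover have "\<bar>\<Sum>s\<in>S. \<epsilon> s * e (z s)\<bar> \<le> 2 * real m"
  proof -
    have "\<bar>\<Sum>s\<in>S. \<epsilon> s * e (z s)\<bar> \<le> (\<Sum>s\<in>S. \<bar>\<epsilon> s * e (z s)\<bar>)"
      by (rule sum_abs)
    also have "\<dots> \<le> (\<Sum>s\<in>S. of_bool (dyadic_cell L (z s) = int p) + of_bool (dyadic_cell L (z s) = int q))"
    proof (rule sum_mono)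
      fix s assume "s \<in> S"
      then have "\<bar>\<epsilon> s * e (z s)\<bar> \<le> 1 * \<bar>e (z s)\<bar>"
        unfolding abs_mult using \<epsilon> by (intro mult_right_mono) auto
      then show "\<bar>\<epsilon> s * e (z s)\<bar> \<le> of_bool (dyadic_cell L (z s) = int p) + of_bool (dyadic_cell L (z s) = int q)"
        using e[of "z s"] by linarith
    qed
    also have "\<dots> = real (card {s \<in> S. dyadic_cell L (z s) = int p}) + card {s \<in> S. dyadic_cell L (z s) = int q}"
      using assms(1) by (simp add: sum.distrib Int_def)
    also have "\<dots> \<le> real m + real m"
      using occupancy[OF p(2)] occupancy[OF q(2)] by linarith
    finally show ?thesis by simp
  qed
  ultimately show ?thesis
    by linarith
qed

subsection \<open>Occupancy of dyadic cells\<close>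

lemma prob_space_iid_points: "prob_space (iid_points d T)"
  unfolding iid_points_def by (intro prob_space_PiM prob_space_uniform_cube)

lemma measurable_iid_component[measurable]:
  assumes "s \<in> {1..T}" "i \<in> {1..d}"
  shows "(\<lambda>x. x s i) \<in> borel_measurable (iid_points d T)"
  using measurable_compose[OF measurable_component_singleton[OF assms(1), of "\<lambda>_. uniform_cube d"]
      measurable_cube_component[OF assms(2)]]
  unfolding iid_points_def .

lemma sets_points_in_cell:
  assumes "i \<in> {1..d}" "S \<subseteq> {1..T}"
  shows "{x \<in> space (iid_points d T). \<forall>s\<in>S. dyadic_cell L (x s i) = int c} \<in> sets (iid_points d T)"
proof (intro sets.sets_Collect_finite_All)
  fix s assume "s \<in> S"
  then have [measurable]: "(\<lambda>x. x s i) \<in> borel_measurable (iid_points d T)"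
    using assms by (intro measurable_iid_component) auto
  show "{x \<in> space (iid_points d T). dyadic_cell L (x s i) = int c} \<in> sets (iid_points d T)"
    by measurable
qed (use assms in \<open>auto intro: finite_subset\<close>)

lemma prob_points_in_cell:
  assumes "i \<in> {1..d}" "S \<subseteq> {1..T}" "c < 2 ^ L"
  shows "measure (iid_points d T) {x \<in> space (iid_points d T). \<forall>s\<in>S. dyadic_cell L (x s i) = int c}
    = (1 / 2 ^ L) ^ card S"
proof -
  interpret Q: prob_space "uniform_cube d" by (rule prob_space_uniform_cube)
  interpret P: product_sigma_finite "\<lambda>_::nat. uniform_cube d" ..
  interpret I: prob_space "iid_points d T" by (rule prob_space_iid_points)
  have "finite S"
    using assms(2) by (rule finite_subset) simp
  define F where "F s = (\<lambda>y. if s \<in> S then of_bool (dyadic_cell L (y i) = int c) else 1 :: real)" for s :: nat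
  have [measurable]: "(\<lambda>y. y i) \<in> uniform_cube d \<rightarrow>\<^sub>M borel"
    using assms(1) by (rule measurable_cube_component)
  have F_int: "integrable (uniform_cube d) (F s)" for s
    by (rule Q.integrable_const_bound[where B = 1]) (auto simp: F_def)
  have F_eq: "integral\<^sup>L (uniform_cube d) (F s) = (if s \<in> S then 1 / 2 ^ L else 1)" for s
  proof (cases "s \<in> S")
    case True
    have "integral\<^sup>L (uniform_cube d) (F s) = (\<integral>z. of_bool (dyadic_cell L z = int c) \<partial>unit_measure)"
      using True integral_cube_component[OF assms(1), of "\<lambda>z. of_bool (dyadic_cell L z = int c)"]
      by (simp add: F_def)
    then show ?thesis
      using True integral_dyadic_cell[OF assms(3)] by simp
  qed (simp add: F_def Q.prob_space)
  let ?E = "{x \<in> space (iid_points d T). \<forall>s\<in>S. dyadic_cell L (x s i) = int c}"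
  have "?E \<in> sets (iid_points d T)"
    by (rule sets_points_in_cell) (use assms in auto)
  then have "measure (iid_points d T) ?E = (\<integral>x. indicator ?E x \<partial>iid_points d T)"
    by simp
  also have "\<dots> = (\<integral>x. (\<Prod>s\<in>{1..T}. F s (x s)) \<partial>iid_points d T)"
  proof (rule Bochner_Integration.integral_cong[OF refl])
    fix x assume "x \<in> space (iid_points d T)"
    have "(\<Prod>s\<in>{1..T}. F s (x s)) = (\<Prod>s\<in>S. of_bool (dyadic_cell L (x s i) = int c))"
      by (rule prod.mono_neutral_cong_right) (use assms(2) in \<open>auto simp: F_def\<close>)
    also have "\<dots> = indicator ?E x"
      using \<open>x \<in> space _\<close> \<open>finite S\<close> by (auto simp: indicator_def)
    finally show "indicator ?E x = (\<Prod>s\<in>{1..T}. F s (x s))" ..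
  qed
  also have "\<dots> = (\<Prod>s\<in>{1..T}. integral\<^sup>L (uniform_cube d) (F s))"
    unfolding iid_points_def by (rule P.product_integral_prod) (use F_int in auto)
  also have "\<dots> = (\<Prod>s\<in>S. 1 / 2 ^ L)"
    unfolding F_eq by (rule prod.mono_neutral_cong_right) (use assms(2) in auto)
  finally show ?thesis
    by simp
qed

text \<open>The event that some cell receives at least \<open>m\<close> points, written over
  \<open>m\<close>-element sets of times so that the union bound applies directly.\<close>

definition crowded :: "nat \<Rightarrow> nat \<Rightarrow> nat \<Rightarrow> nat \<Rightarrow> (nat \<Rightarrow> nat \<Rightarrow> real) set" where
  "crowded d T L m = (\<Union>i\<in>{1..d}. \<Union>c\<in>{..<2 ^ L}. \<Union>S\<in>{S. S \<subseteq> {1..T} \<and> card S = m}.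
     {x \<in> space (iid_points d T). \<forall>s\<in>S. dyadic_cell L (x s i) = int c})"

lemma sets_crowded: "crowded d T L m \<in> sets (iid_points d T)"
  unfolding crowded_def
  by (intro sets.finite_UN sets_points_in_cell) auto

lemma prob_crowded_le:
  "measure (iid_points d T) (crowded d T L m) \<le> d * (2 ^ L * (real T ^ m * (1 / 2 ^ L) ^ m))"
proof -
  interpret I: prob_space "iid_points d T" by (rule prob_space_iid_points)
  let ?E = "\<lambda>i c S. {x \<in> space (iid_points d T). \<forall>s\<in>S. dyadic_cell L (x s i) = int c}"
  let ?Sm = "{S. S \<subseteq> {1..T} \<and> card S = m}"
  have fin: "finite ?Sm"
    by (rule finite_subset[of _ "Pow {1..T}"]) auto
  have 1: "measure (iid_points d T) (\<Union>S\<in>?Sm. ?E i c S) \<le> real T ^ m * (1 / 2 ^ L) ^ m"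
    if "i \<in> {1..d}" "c < 2 ^ L" for i c
  proof -
    have "measure (iid_points d T) (\<Union>S\<in>?Sm. ?E i c S) \<le> (\<Sum>S\<in>?Sm. measure (iid_points d T) (?E i c S))"
      using that by (intro measure_UNION_le[OF fin] sets_points_in_cell) auto
    also have "\<dots> = (\<Sum>S\<in>?Sm. (1 / 2 ^ L) ^ m)"
      using that by (intro sum.cong refl) (simp add: prob_points_in_cell)
    also have "\<dots> = real (T choose m) * (1 / 2 ^ L) ^ m"
      by (simp add: n_subsets)
    also have "\<dots> \<le> real T ^ m * (1 / 2 ^ L) ^ m"
    proof (intro mult_right_mono)
      have "T choose m \<le> T ^ m"
        by (cases "m \<le> T") (auto simp: binomial_le_pow binomial_eq_0)
      then show "real (T choose m) \<le> real T ^ m"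
        by (metis of_nat_le_iff of_nat_power)
    qed simp
    finally show ?thesis .
  qed
  have m1: "(\<Union>S\<in>?Sm. ?E i c S) \<in> sets (iid_points d T)" if "i \<in> {1..d}" for i c
    using that fin by (intro sets.finite_UN sets_points_in_cell) auto
  have 2: "measure (iid_points d T) (\<Union>c\<in>{..<2 ^ L}. \<Union>S\<in>?Sm. ?E i c S) \<le> 2 ^ L * (real T ^ m * (1 / 2 ^ L) ^ m)"
    if "i \<in> {1..d}" for i
  proof -
    have "measure (iid_points d T) (\<Union>c\<in>{..<2 ^ L}. \<Union>S\<in>?Sm. ?E i c S)
        \<le> (\<Sum>c\<in>{..<2 ^ L}. measure (iid_points d T) (\<Union>S\<in>?Sm. ?E i c S))"
      using that by (intro measure_UNION_le m1) auto
    also have "\<dots> \<le> of_nat (card {..<2 ^ L :: nat}) * (real T ^ m * (1 / 2 ^ L) ^ m)"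
      using that 1 by (intro sum_bounded_above) auto
    finally show ?thesis by simp
  qed
  have "measure (iid_points d T) (crowded d T L m)
      \<le> (\<Sum>i\<in>{1..d}. measure (iid_points d T) (\<Union>c\<in>{..<2 ^ L}. \<Union>S\<in>?Sm. ?E i c S))"
    unfolding crowded_def by (intro measure_UNION_le sets.finite_UN m1) auto
  also have "\<dots> \<le> of_nat (card {1..d}) * (2 ^ L * (real T ^ m * (1 / 2 ^ L) ^ m))"
    using 2 by (intro sum_bounded_above) auto
  finally show ?thesis by simp
qed

lemma card_cell_less_if_not_crowded:
  assumes "x \<in> space (iid_points d T)" "x \<notin> crowded d T L m" "i \<in> {1..d}" "c < 2 ^ L"
  shows "card {s \<in> {1..T}. dyadic_cell L (x s i) = int c} < m"
proof (rule ccontr)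
  assume "\<not> ?thesis"
  then have "m \<le> card {s \<in> {1..T}. dyadic_cell L (x s i) = int c}"
    by simp
  then obtain S where S: "S \<subseteq> {s \<in> {1..T}. dyadic_cell L (x s i) = int c}" "card S = m"
    by (rule obtain_subset_with_card_n)
  then have "x \<in> crowded d T L m"
    unfolding crowded_def by (intro UN_I[of i] UN_I[of c] UN_I[of S]) (use assms S in auto)
  then show False
    using assms(2) by simp
qed

subsection \<open>The upper bound\<close>

text \<open>Doubling the exponent gives at least \<open>T^2\<close> cells per coordinate, so that
  with \<open>T\<close> points a cell rarely holds more than a bounded number.\<close>

definition haar_depth :: "nat \<Rightarrow> nat" where
  "haar_depth T = 2 * nat \<lceil>log 2 (real T)\<rceil>"

lemma haar_depth_bounds:
  assumes "2 \<le> T"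
  shows "(real T)\<^sup>2 \<le> 2 ^ haar_depth T" "2 ^ haar_depth T \<le> 4 * (real T)\<^sup>2"
    "real (haar_depth T) \<le> 4 * log 2 (real T)" "1 \<le> log 2 (real T)"
proof -
  show log: "1 \<le> log 2 (real T)"
    using assms by (subst le_log_iff) auto
  define n where "n = nat \<lceil>log 2 (real T)\<rceil>"
  have n: "log 2 (real T) \<le> n" "n \<le> log 2 (real T) + 1"
    using log unfolding n_def by linarith+
  have "real T = 2 powr (log 2 (real T))"
    using assms by simp
  also have "\<dots> \<le> 2 powr real n"
    using n by (intro powr_mono) auto
  also have "\<dots> = 2 ^ n"
    by (simp add: powr_realpow)
  finally have 1: "real T \<le> 2 ^ n" .
  have "2 ^ n = 2 powr real n"
    by (simp add: powr_realpow)
  also have "\<dots> \<le> 2 powr (log 2 (real T) + 1)"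
    using n by (intro powr_mono) auto
  also have "\<dots> = 2 * real T"
    using assms by (simp add: powr_add)
  finally have 2: "2 ^ n \<le> 2 * real T" .
  have eq: "(2::real) ^ haar_depth T = (2 ^ n)\<^sup>2"
    by (simp add: haar_depth_def n_def power_mult power2_eq_square mult_2 power_add)
  show "(real T)\<^sup>2 \<le> 2 ^ haar_depth T"
    unfolding eq using 1 by (intro power_mono) auto
  have "((2::real) ^ n)\<^sup>2 \<le> (2 * real T)\<^sup>2"
    using 2 by (intro power_mono) auto
  then show "2 ^ haar_depth T \<le> 4 * (real T)\<^sup>2"
    unfolding eq by (simp add: power_mult_distrib)
  have "real (haar_depth T) = 2 * real n"
    by (simp add: haar_depth_def n_def)
  then show "real (haar_depth T) \<le> 4 * log 2 (real T)"
    using n log by linarith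
qed

definition haar_greedy :: "nat \<Rightarrow> nat \<Rightarrow> nat \<Rightarrow> (nat \<Rightarrow> nat \<Rightarrow> real) \<Rightarrow> real" where
  "haar_greedy d T = sign_system.greedy (haar_index d (haar_depth T)) (haar_groups d (haar_depth T)) cube_haar"

lemma online_haar_greedy:
  assumes "1 \<le> d"
  shows "online_algorithm d T (haar_greedy d T)"
proof -
  interpret H: sign_system "uniform_cube d" "haar_index d (haar_depth T)" "haar_groups d (haar_depth T)"
      haar_group cube_haar haar_weight
    by (rule sign_system_haar[OF assms])
  show ?thesis
    unfolding online_algorithm_def haar_greedy_def iid_points_def
    by (intro ballI H.measurable_greedy) auto
qed

text \<open>The endpoint 1 is excluded because it falls into cell \<open>2 ^ l\<close> of level
  \<open>l\<close>, beyond the cells of \<open>[0,1)\<close>.\<close>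

lemma AE_iid_points_unit:
  "AE x in iid_points d T. \<forall>s\<in>{1..T}. \<forall>i\<in>{1..d}. 0 \<le> x s i \<and> x s i < 1"
proof -
  have "AE z in unit_measure. 0 \<le> z \<and> z < 1"
  proof (rule AE_uniform_measureI)
    show "AE z in lborel. z \<in> {0..1} \<longrightarrow> 0 \<le> z \<and> z < (1::real)"
      using AE_lborel_singleton[of 1] by eventually_elim auto
  qed simp
  then have "AE y in uniform_cube d. 0 \<le> y i \<and> y i < 1" if "i \<in> {1..d}" for i
    unfolding uniform_cube_def using that prob_space_unit_measure
    by (intro AE_PiM_component[where P = "\<lambda>z. 0 \<le> z \<and> z < 1"]) auto
  then have "AE y in uniform_cube d. \<forall>i\<in>{1..d}. 0 \<le> y i \<and> y i < 1"
    by (intro AE_finite_allI) auto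
  then have "AE x in iid_points d T. \<forall>i\<in>{1..d}. 0 \<le> x s i \<and> x s i < 1" if "s \<in> {1..T}" for s
    unfolding iid_points_def using that prob_space_uniform_cube
    by (intro AE_PiM_component[where P = "\<lambda>y. \<forall>i\<in>{1..d}. 0 \<le> y i \<and> y i < 1"]) auto
  then show ?thesis
    by (rule AE_finite_allI[OF finite_atLeastAtMost])
qed

lemma disc_le_of_haar_coefficients:
  assumes x: "x \<in> space (iid_points d T)" "x \<notin> crowded d T L m"
      "\<And>s i. s \<in> {1..T} \<Longrightarrow> i \<in> {1..d} \<Longrightarrow> 0 \<le> x s i \<and> x s i < 1"
    and \<epsilon>: "\<And>s. s \<in> {1..T} \<Longrightarrow> \<bar>\<epsilon> s\<bar> \<le> 1"
    and coeff: "\<And>a. a \<in> haar_index d L \<Longrightarrow> \<bar>\<Sum>s=1..t. \<epsilon> s * cube_haar a (x s)\<bar> \<le> M"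
    and "i \<in> {1..d}" "t \<in> {1..T}" "u \<in> {1..T}" "v \<in> {1..T}"
  shows "disc \<epsilon> x i t {x u i..x v i} \<le> 2 * (M * (1 + L / 2)) + 2 * real m"
  unfolding disc_def
proof (rule interval_sum_bound[where z = "\<lambda>s. x s i" and L = L])
  have one: "1 \<in> {1..d}" using assms(6) by auto
  have const: "\<bar>\<Sum>s=1..t. \<epsilon> s * of_bool (dyadic_cell 0 (x s i) = 0)\<bar> \<le> M"
  proof -
    \<comment> \<open>With all coordinates in \<open>[0,1)\<close>, the constant function of
      coordinate 1 serves coordinate \<open>i\<close> as well.\<close>
    have "dyadic_cell 0 (x s i') = 0" if "s \<in> {1..t}" "i' \<in> {1..d}" for s i'
      using x(3)[of s i'] that assms(7) by (simp add: dyadic_cell_def floor_eq_iff)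
    then have "(\<Sum>s=1..t. \<epsilon> s * of_bool (dyadic_cell 0 (x s i) = 0)) = (\<Sum>s=1..t. \<epsilon> s * cube_haar None (x s))"
      using assms(6) one by (intro sum.cong) (auto simp: cube_haar_def)
    then show ?thesis
      using coeff[of None] by (simp add: haar_index_def)
  qed
  have haar: "\<bar>\<Sum>s=1..t. \<epsilon> s * haar l j (x s i)\<bar> \<le> M" if "l < L" "j < 2 ^ l" for l j
    using coeff[of "Some (i, l, j)"] that assms(6) by (auto simp: haar_index_def cube_haar_def)
  show "\<bar>\<Sum>s=1..t. \<epsilon> s * of_bool (dyadic_cell L (x s i) < int q)\<bar> \<le> M * (1 + L / 2)" if "q \<le> 2 ^ L" for q
    by (rule dyadic_prefix_bound[OF _ const haar]) (use x(3) assms(6,7) that in auto)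
  show "card {s \<in> {1..t}. dyadic_cell L (x s i) = int c} \<le> m" if "c < 2 ^ L" for c
  proof -
    have "card {s \<in> {1..t}. dyadic_cell L (x s i) = int c} \<le> card {s \<in> {1..T}. dyadic_cell L (x s i) = int c}"
      using assms(7) by (intro card_mono) auto
    then show ?thesis
      using card_cell_less_if_not_crowded[OF x(1,2) assms(6) that] by linarith
  qed
qed (use x(3) \<epsilon> assms in auto)

lemma disc_le_time:
  assumes "\<And>s. s \<in> {1..t} \<Longrightarrow> \<bar>\<epsilon> s\<bar> \<le> 1"
  shows "disc \<epsilon> x i t I \<le> t"
proof -
  have "disc \<epsilon> x i t I \<le> (\<Sum>s=1..t. \<bar>\<epsilon> s * indicator I (x s i)\<bar>)"
    unfolding disc_def by (rule sum_abs)
  also have "\<dots> \<le> (\<Sum>s=1..t. 1)"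
    by (rule sum_mono) (use assms in \<open>auto simp: indicator_def\<close>)
  finally show ?thesis by simp
qed

lemma measurable_signing:
  assumes "online_algorithm d T A" "s \<in> {1..T}"
  shows "(\<lambda>x. signing A x s) \<in> iid_points d T \<rightarrow>\<^sub>M count_space {-1, 1}"
proof -
  have "(\<lambda>x. restrict x {1..s}) \<in> iid_points d T \<rightarrow>\<^sub>M iid_points d s"
    unfolding iid_points_def using assms(2) by (intro measurable_restrict_subset) auto
  moreover have "A s \<in> iid_points d s \<rightarrow>\<^sub>M count_space {-1, 1}"
    using assms unfolding online_algorithm_def by auto
  ultimately show ?thesis
    unfolding signing_def by (rule measurable_compose)
qed

lemma borel_measurable_count_space_real: "(\<lambda>z::real. z) \<in> count_space S \<rightarrow>\<^sub>M borel"
  by simp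

lemma borel_measurable_signing:
  assumes "online_algorithm d T A" "s \<in> {1..T}"
  shows "(\<lambda>x. signing A x s) \<in> borel_measurable (iid_points d T)"
  using measurable_compose[OF measurable_signing[OF assms] borel_measurable_count_space_real] .

text \<open>With \<open>m = 2 * k + 4\<close> the union bound is at most
  \<open>T^(m + 1) / T^(2 * m - 2)\<close>, that is \<open>1 / T^(2 * k + 1)\<close>; one factor
  \<open>T >= 2\<close> yields the 1/2.\<close>

lemma prob_crowded_depth_le:
  assumes "d \<le> T" "2 \<le> T"
  shows "measure (iid_points d T) (crowded d T (haar_depth T) (2 * k + 4)) \<le> 1 / (2 * real T ^ (2 * k))"
proof -
  define N where "N = (2::real) ^ haar_depth T"
  have N: "(real T)\<^sup>2 \<le> N" "0 < N"
    using haar_depth_bounds(1)[OF assms(2)] by (auto simp: N_def)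
  have T: "2 \<le> real T" "0 < real T"
    using assms by auto
  have "measure (iid_points d T) (crowded d T (haar_depth T) (2 * k + 4))
      \<le> d * (N * (real T ^ (2 * k + 4) * (1 / N) ^ (2 * k + 4)))"
    unfolding N_def by (rule prob_crowded_le)
  also have "\<dots> = d * real T ^ (2 * k + 4) / N ^ (2 * k + 3)"
  proof -
    have "N ^ (2 * k + 4) = N * N ^ (2 * k + 3)"
      by (simp add: add.commute flip: power_Suc)
    then show ?thesis
      using N(2) by (simp add: power_divide)
  qed
  also have "\<dots> \<le> real T * real T ^ (2 * k + 4) / ((real T)\<^sup>2) ^ (2 * k + 3)"
  proof (rule frac_le)
    show "real d * real T ^ (2 * k + 4) \<le> real T * real T ^ (2 * k + 4)"
      using assms(1) by (intro mult_right_mono) auto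
    show "((real T)\<^sup>2) ^ (2 * k + 3) \<le> N ^ (2 * k + 3)"
      using N(1) by (rule power_mono) simp
  qed (use T in auto)
  also have "\<dots> = 1 / (real T * real T ^ (2 * k))"
  proof -
    have "((real T)\<^sup>2) ^ (2 * k + 3) = (real T * real T ^ (2 * k + 4)) * (real T * real T ^ (2 * k))"
      by (simp add: add.commute flip: power_mult power_Suc power_add)
    then show ?thesis using T(2) by simp
  qed
  also have "\<dots> \<le> 1 / (2 * real T ^ (2 * k))"
    using T by (intro divide_left_mono mult_right_mono mult_pos_pos) auto
  finally show ?thesis .
qed

text \<open>In \<open>C\<close>, the factor 30 is \<open>2 * 5 * 3\<close>: two prefixes,
  \<open>5 * d * lg\<close> for the number of groups, and \<open>3 * lg\<close> for
  \<open>1 + L / 2\<close>. The factor \<open>2 * k + 9\<close> comes from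
  \<open>ln (2 * K)\<close>, and \<open>4 * k + 8\<close> from two boundary cells with up to
  \<open>2 * k + 4\<close> points each.\<close>

lemma haar_greedy_disc:
  fixes k :: nat
  defines "C \<equiv> 30 * (2 * real k + 9) + (4 * real k + 8)"
  assumes d: "1 \<le> d" and T: "2 \<le> T"
  shows "measure (iid_points d T)
            {x \<in> space (iid_points d T).
               \<forall>i\<in>{1..d}. \<forall>I. is_interval I \<and> I \<subseteq> {0..1} \<longrightarrow>
                 (MAX t\<in>{1..T}. disc (signing (haar_greedy d T) x) x i t I)
                   \<le> C * real d * log 2 (real T) ^ 3}
          \<ge> 1 - 1 / (real d * real T) ^ k"
proof -
  define L where "L = haar_depth T"
  interpret H: sign_system "uniform_cube d" "haar_index d L" "haar_groups d L"
      haar_group cube_haar haar_weight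
    by (rule sign_system_haar[OF d])
  interpret P: prob_space "iid_points d T" by (rule prob_space_iid_points)
  define lg where "lg = log 2 (real T)"
  have lg: "1 \<le> lg" "real L \<le> 4 * lg"
    using haar_depth_bounds[OF T] by (auto simp: lg_def L_def)
  have C: "1 \<le> C"
    by (simp add: C_def)
  have T2: "2 \<le> real T" using T by simp
  define B where "B = C * real d * lg ^ 3"
  have T1: "1 \<le> T" using T by simp
  have B0: "0 \<le> B"
    using C lg by (simp add: B_def)
  define \<epsilon> where "\<epsilon> = signing (haar_greedy d T)"
  have \<epsilon>_eq: "\<epsilon> x t = H.greedy t x" if "1 \<le> t" for x t
    unfolding \<epsilon>_def signing_def haar_greedy_def L_def[symmetric]
    by (rule H.greedy_cong) (use that in auto)
  have \<epsilon>_abs: "\<bar>\<epsilon> x t\<bar> \<le> 1" if "1 \<le> t" for x t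
    using that by (simp add: \<epsilon>_eq H.abs_greedy)
  let ?P = "iid_points d T"
  define G where "G = {x \<in> space ?P. \<forall>i\<in>{1..d}. \<forall>I. is_interval I \<and> I \<subseteq> {0..1} \<longrightarrow>
                 (MAX t\<in>{1..T}. disc (\<epsilon> x) x i t I) \<le> B}"
  have G_sets: "G \<in> sets ?P"
    unfolding G_def \<epsilon>_def
    by (intro sets_all_intervals_disc_le borel_measurable_signing[OF online_haar_greedy[OF d]]
        measurable_iid_component B0) (use T in auto)
  have G_iff: "x \<in> G \<longleftrightarrow> x \<in> space ?P \<and> (\<forall>i\<in>{1..d}. \<forall>u\<in>{1..T}. \<forall>v\<in>{1..T}. 0 \<le> x u i \<and> x v i \<le> 1 \<longrightarrow>
      (\<forall>t\<in>{1..T}. disc (\<epsilon> x) x i t {x u i..x v i} \<le> B))" for x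
    unfolding G_def all_intervals_disc_le_iff[OF B0 T1] by simp
  have "1 - 1 / (real d * real T) ^ k \<le> measure ?P G"
  proof (cases "d \<le> T")
    \<comment> \<open>For \<open>d > T\<close> the trivial bound by the number of points
      suffices.\<close>
    case False
    have "x \<in> G" if x: "x \<in> space ?P" for x
      unfolding G_iff
    proof (intro conjI x ballI impI)
      fix i u v t assume t: "t \<in> {1..T}"
      have "disc (\<epsilon> x) x i t {x u i..x v i} \<le> t"
        by (rule disc_le_time) (use \<epsilon>_abs in auto)
      also have "\<dots> \<le> 1 * real d * 1 ^ 3"
        using t False by simp
      also have "\<dots> \<le> B"
        unfolding B_def using C lg by (intro mult_mono power_mono) auto
      finally show "disc (\<epsilon> x) x i t {x u i..x v i} \<le> B" .
    qed
    then have "G = space ?P"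
      unfolding G_def by auto
    then show ?thesis
      by (simp add: P.prob_space)
  next
    case True
    \<comment> \<open>Markov and a union bound over \<open>T\<close> times cost
      \<open>5 * T^4 / K\<close>; the exponent leaves
      \<open>T^7 / K = 1 / (2 * T^(2 * k))\<close>.\<close>
    define K where "K = 2 * real T ^ (2 * k + 7)"
    have K: "0 < K"
      using T2 by (simp add: K_def)
    define Z where "Z t = {x \<in> space ?P. K \<le> H.potential (H.greedy_state x t)}" for t
    have Z_sets: "Z t \<in> sets ?P" if "t \<in> {1..T}" for t
    proof -
      have [measurable]: "(\<lambda>x. H.potential (H.greedy_state x t)) \<in> borel_measurable ?P"
        using H.integrable_potential_greedy[of t T] that
        by (auto simp: iid_points_def dest: borel_measurable_integrable)
      show ?thesis
        unfolding Z_def by measurable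
    qed
    have card_J: "real (card (haar_index d L)) \<le> 4 * real T ^ 3"
    proof -
      have "real (card (haar_index d L)) \<le> real (d * 2 ^ L)"
        using card_haar_index[OF d, of L] by (simp only: of_nat_le_iff)
      also have "\<dots> = real d * 2 ^ L"
        by simp
      also have "\<dots> \<le> real T * (4 * (real T)\<^sup>2)"
        using haar_depth_bounds(2)[OF T] True by (intro mult_mono) (auto simp: L_def)
      finally show ?thesis
        by (simp add: power2_eq_square power3_eq_cube)
    qed
    have prob_Z: "measure ?P (Z t) \<le> 5 * real T ^ 3 / K" if "t \<in> {1..T}" for t
    proof -
      have "measure ?P (Z t) \<le> (\<integral>x. H.potential (H.greedy_state x t) \<partial>?P) / K"
        unfolding Z_def
        by (rule integral_Markov_inequality_measure[OF _ sets.empty_sets])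
          (use H.integrable_potential_greedy[of t T] H.potential_greedy_state_bounds(1) that K in
            \<open>auto simp: iid_points_def\<close>)
      also have "\<dots> \<le> (card (haar_index d L) + 2 * t) / K"
        using H.expected_potential_greedy_le[of t T] that K
        by (intro divide_right_mono) (auto simp: iid_points_def)
      also have "\<dots> \<le> 5 * real T ^ 3 / K"
      proof (intro divide_right_mono)
        have "real T * 2 \<le> real T * (real T)\<^sup>2"
          using T2 power_mono[of 2 "real T" 2] by (intro mult_left_mono) auto
        then have "2 * real T \<le> real T ^ 3"
          by (simp add: power2_eq_square power3_eq_cube mult.commute)
        then show "real (card (haar_index d L) + 2 * t) \<le> 5 * real T ^ 3"
          using card_J that by simp
      qed (use K in simp)
      finally show ?thesis .
    qed
    define B1 where "B1 = (\<Union>t\<in>{1..T}. Z t)"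
    define B2 where "B2 = crowded d T L (2 * k + 4)"
    have B_sets: "B1 \<in> sets ?P" "B2 \<in> sets ?P"
      unfolding B1_def B2_def using Z_sets by (auto intro: sets_crowded)
    have "measure ?P B1 \<le> (\<Sum>t\<in>{1..T}. measure ?P (Z t))"
      unfolding B1_def by (rule measure_UNION_le) (use Z_sets in auto)
    also have "\<dots> \<le> of_nat (card {1..T}) * (5 * real T ^ 3 / K)"
      by (rule sum_bounded_above) (rule prob_Z)
    also have "\<dots> = 5 * real T ^ 4 / K"
      by (simp flip: power_Suc)
    also have "\<dots> \<le> real T ^ 7 / K"
    proof (intro divide_right_mono)
      have "2 ^ 3 * real T ^ 4 \<le> real T ^ 3 * real T ^ 4"
        using T2 by (intro mult_right_mono power_mono) auto
      then have "8 * real T ^ 4 \<le> real T ^ 7"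
        by (simp flip: power_add)
      then show "5 * real T ^ 4 \<le> real T ^ 7"
        using zero_le_power[of "real T" 4] by linarith
    qed (use K in simp)
    also have "\<dots> = 1 / (2 * real T ^ (2 * k))"
      using T2 by (simp add: K_def power_add)
    finally have prob_B1: "measure ?P B1 \<le> 1 / (2 * real T ^ (2 * k))" .
    have prob_B2: "measure ?P B2 \<le> 1 / (2 * real T ^ (2 * k))"
      unfolding B2_def L_def using True T by (rule prob_crowded_depth_le)

    have good: "x \<in> G" if x: "x \<in> space ?P" "x \<notin> B1" "x \<notin> B2"
        and unit: "\<forall>s\<in>{1..T}. \<forall>i\<in>{1..d}. 0 \<le> x s i \<and> x s i < 1" for x
      unfolding G_iff
    proof (intro conjI x(1) ballI impI)
      fix i u v t assume i: "i \<in> {1..d}" and uv: "u \<in> {1..T}" "v \<in> {1..T}" and t: "t \<in> {1..T}"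
      define M where "M = 5 * (2 * real k + 9) * real d * lg\<^sup>2"
      have M0: "0 \<le> M"
        by (simp add: M_def)
      have coeff: "\<bar>\<Sum>s=1..t. \<epsilon> x s * cube_haar a (x s)\<bar> \<le> M" if a: "a \<in> haar_index d L" for a
      proof -
        have "x \<notin> Z t"
          using x(2) t by (auto simp: B1_def)
        then have "H.potential (H.greedy_state x t) < K"
          using x(1) by (simp add: Z_def)
        then have "\<bar>H.greedy_state x t a\<bar> \<le> card (haar_groups d L) * ln (2 * K)"
          by (rule H.abs_le_of_potential_less[OF a])
        also have "\<dots> \<le> (5 * real d * lg) * ((2 * real k + 9) * lg)"
        proof (intro mult_mono)
          have "real d * real L \<le> real d * (4 * lg)"
            using lg by (intro mult_left_mono) auto
          moreover have "1 * 1 \<le> real d * lg"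
            using lg d by (intro mult_mono) auto
          ultimately show "real (card (haar_groups d L)) \<le> 5 * real d * lg"
            by (simp add: card_haar_groups)
          have "2 ^ 2 * real T ^ (2 * k + 7) \<le> (real T) ^ 2 * real T ^ (2 * k + 7)"
            using T2 by (intro mult_right_mono power_mono) auto
          then have "2 * K \<le> real T ^ (2 * k + 9)"
            by (simp add: K_def add.commute flip: power_add)
          then have "ln (2 * K) \<le> ln (real T ^ (2 * k + 9))"
            using K by (subst ln_le_cancel_iff) (use T2 in auto)
          also have "\<dots> = (2 * real k + 9) * ln (real T)"
            using T2 by (simp add: ln_realpow)
          also have "\<dots> \<le> (2 * real k + 9) * lg"
          proof (intro mult_left_mono)
            have "ln (real T) * ln 2 \<le> ln (real T) * 1"
              using T2 ln_2_less_1 by (intro mult_left_mono) auto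
            then show "ln (real T) \<le> lg"
              unfolding lg_def log_def by (subst le_divide_eq) auto
          qed simp
          finally show "ln (2 * K) \<le> (2 * real k + 9) * lg" .
          have "1 \<le> real T ^ (2 * k + 7)"
            using T2 by (intro one_le_power) auto
          then show "0 \<le> ln (2 * K)"
            by (intro ln_ge_zero) (simp add: K_def)
        qed (use lg in auto)
        also have "\<dots> = M"
          by (simp add: M_def power2_eq_square)
        finally show ?thesis
          unfolding H.greedy_state_eq H.signed_count_def by (simp add: \<epsilon>_eq)
      qed
      have "disc (\<epsilon> x) x i t {x u i..x v i} \<le> 2 * (M * (1 + L / 2)) + 2 * real (2 * k + 4)"
        by (rule disc_le_of_haar_coefficients[where d = d and T = T])
          (use x unit \<epsilon>_abs coeff i t uv in \<open>auto simp: B2_def\<close>)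
      also have "\<dots> \<le> 2 * (M * (3 * lg)) + (4 * real k + 8) * (real d * lg ^ 3)"
      proof (intro add_mono mult_left_mono)
        show "1 + real L / 2 \<le> 3 * lg"
          using lg by linarith
        have "1 * 1 \<le> real d * lg ^ 3"
          using d lg by (intro mult_mono one_le_power) auto
        then have "(4 * real k + 8) * 1 \<le> (4 * real k + 8) * (real d * lg ^ 3)"
          by (intro mult_left_mono) auto
        then show "2 * real (2 * k + 4) \<le> (4 * real k + 8) * (real d * lg ^ 3)"
          by simp
      qed (use M0 in auto)
      also have "\<dots> = B"
        by (simp add: B_def C_def M_def power2_eq_square power3_eq_cube algebra_simps)
      finally show "disc (\<epsilon> x) x i t {x u i..x v i} \<le> B" .
    qed
    \<comment> \<open>The bad event is compared up to the null set where some coordinate lies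
      outside \<open>[0,1)\<close>.\<close>
    have "measure ?P (space ?P - G) \<le> measure ?P (B1 \<union> B2)"
    proof (rule P.finite_measure_mono_AE)
      show "AE x in ?P. x \<in> space ?P - G \<longrightarrow> x \<in> B1 \<union> B2"
        using AE_iid_points_unit[where d = d and T = T] by eventually_elim (use good in blast)
    qed (use B_sets in auto)
    also have "\<dots> \<le> measure ?P B1 + measure ?P B2"
      using B_sets by (rule measure_Un_le)
    also have "\<dots> \<le> 1 / (2 * real T ^ (2 * k)) + 1 / (2 * real T ^ (2 * k))"
      using prob_B1 prob_B2 by (rule add_mono)
    also have "\<dots> = 1 / real T ^ (2 * k)"
      by simp
    \<comment> \<open>The assumption \<open>d <= T\<close> turns the power of \<open>T^2\<close>
      into one of \<open>d * T\<close>.\<close>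
    also have "\<dots> \<le> 1 / (real d * real T) ^ k"
    proof (intro divide_left_mono)
      have "(real d * real T) ^ k \<le> (real T * real T) ^ k"
        using True by (intro power_mono mult_right_mono) auto
      then show "(real d * real T) ^ k \<le> real T ^ (2 * k)"
        by (simp add: power_mult power2_eq_square)
    qed (use T2 d in auto)
    finally show ?thesis
      using P.prob_compl[OF G_sets] by simp
  qed
  then show ?thesis
    unfolding G_def \<epsilon>_def B_def lg_def .
qed

subsection \<open>The lower bound\<close>

text \<open>The least \<open>L\<close> with \<open>T <= d * 2 ^ L\<close>, replaced by 1 when it is
  0, which means \<open>T = d\<close>. The lower bound on \<open>d * 2 ^ L\<close> gives
  \<open>L >= log 2 (T / d)\<close>; the upper one keeps the Haar functions at no more than
  \<open>2 * T\<close>.\<close>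

lemma exists_depth:
  assumes "1 \<le> d" "d \<le> (T::nat)"
  shows "\<exists>L\<ge>1. d * 2 ^ L \<le> 2 * T \<and> T \<le> d * 2 ^ L"
proof -
  define n where "n = (LEAST n. T \<le> d * 2 ^ n)"
  have "T \<le> 1 * 2 ^ T"
    by (simp add: less_imp_le)
  also have "\<dots> \<le> d * 2 ^ T"
    using assms(1) by (rule mult_right_mono) simp
  finally have n: "T \<le> d * 2 ^ n"
    unfolding n_def by (rule LeastI)
  show ?thesis
  proof (cases n)
    case 0
    then show ?thesis
      using n assms by (intro exI[of _ 1]) auto
  next
    case (Suc m)
    then have "\<not> T \<le> d * 2 ^ m"
      unfolding n_def by (metis lessI not_less_Least)
    then show ?thesis
      using n Suc by (intro exI[of _ n]) (auto simp: One_nat_def)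
  qed
qed

text \<open>A Haar sum is the difference of the signed sums of two half cells, so one half carries
  at least half of it; hence the threshold \<open>2 * B\<close>.\<close>

lemma large_disc_of_haar_coefficient:
  assumes "1 \<le> d" "a \<in> haar_index d L" "\<bar>\<Sum>s=1..t. \<epsilon> s * cube_haar a (x s)\<bar> > 2 * B" "0 \<le> B"
  shows "\<exists>i\<in>{1..d}. \<exists>I. is_interval I \<and> I \<subseteq> {0..1} \<and> disc \<epsilon> x i t I \<ge> B"
proof (cases a)
  case None
  let ?I = "{z. dyadic_cell 0 z = int 0}"
  have "disc \<epsilon> x 1 t ?I = \<bar>\<Sum>s=1..t. \<epsilon> s * cube_haar a (x s)\<bar>"
    unfolding disc_def None by (simp add: cube_haar_def indicator_def of_bool_def)
  then have "B \<le> disc \<epsilon> x 1 t ?I"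
    using assms(3,4) by linarith
  moreover have "1 \<in> {1..d}"
    using assms(1) by simp
  ultimately show ?thesis
    using dyadic_interval[of 0 0] by (metis less_one power_0)
next
  case (Some p)
  obtain i l j where p: "p = (i, l, j)" by (cases p)
  have ij: "i \<in> {1..d}" "j < 2 ^ l"
    using assms(2) by (auto simp: haar_index_def Some p)
  let ?I = "{z. dyadic_cell (Suc l) z = int (2 * j)}"
  let ?I' = "{z. dyadic_cell (Suc l) z = int (2 * j + 1)}"
  have "(\<Sum>s=1..t. \<epsilon> s * cube_haar a (x s))
      = (\<Sum>s=1..t. \<epsilon> s * indicator ?I (x s i)) - (\<Sum>s=1..t. \<epsilon> s * indicator ?I' (x s i))"
    unfolding sum_subtractf[symmetric]
    by (intro sum.cong refl) (auto simp: cube_haar_def haar_def Some p indicator_def)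
  then have "2 * B \<le> disc \<epsilon> x i t ?I + disc \<epsilon> x i t ?I'"
    using assms(3) unfolding disc_def by linarith
  then have "B \<le> disc \<epsilon> x i t ?I \<or> B \<le> disc \<epsilon> x i t ?I'"
    by linarith
  moreover have "2 * j < 2 ^ Suc l" "2 * j + 1 < 2 ^ Suc l"
    using ij by auto
  ultimately show ?thesis
    using ij(1) dyadic_interval[of "2 * j" "Suc l"] dyadic_interval[of "2 * j + 1" "Suc l"] by blast
qed

text \<open>If every interval discrepancy stays below the target \<open>B\<close>, then all Haar
  sums stay within \<open>b = sqrt n / 8\<close>, and the growth of the quadratic potential allows
  this with probability at most 1/4.\<close>

lemma deterministic_lower_bound:
  assumes d: "1 \<le> d" and T: "d \<le> T" and A: "online_algorithm d T A"
  shows "measure (iid_points d T) {x \<in> space (iid_points d T).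
      \<exists>i\<in>{1..d}. \<exists>I. is_interval I \<and> I \<subseteq> {0..1} \<and>
        (MAX t\<in>{1..T}. disc (signing A x) x i t I) \<ge> 1 / 32 * sqrt (real d * log 2 (real T / real d))} \<ge> 3 / 4"
proof -
  let ?P = "iid_points d T"
  interpret P: prob_space ?P by (rule prob_space_iid_points)
  have T1: "1 \<le> T" using d T by simp
  define B where "B = 1 / 32 * sqrt (real d * log 2 (real T / real d))"
  have "0 \<le> log 2 (real T / real d)"
    using d T by (intro zero_le_log_cancel_iff[THEN iffD2]) auto
  then have B0: "0 \<le> B"
    by (simp add: B_def)
  define E where "E = {x \<in> space ?P. \<exists>i\<in>{1..d}. \<exists>I. is_interval I \<and> I \<subseteq> {0..1} \<and>
        (MAX t\<in>{1..T}. disc (signing A x) x i t I) \<ge> B}"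
  have EI: "x \<in> E" if "x \<in> space ?P" "t \<in> {1..T}" "i \<in> {1..d}" "is_interval I" "I \<subseteq> {0..1}"
      "B \<le> disc (signing A x) x i t I" for x t i I
  proof -
    have "disc (signing A x) x i t I \<le> (MAX t\<in>{1..T}. disc (signing A x) x i t I)"
      using that(2) by (intro Max_ge) auto
    then show ?thesis
      unfolding E_def using that order_trans by blast
  qed
  have "3 / 4 \<le> measure ?P E"
  proof (cases "B = 0")
    \<comment> \<open>This is the case \<open>T = d\<close>, settled by the empty interval because
      the measurability lemma needs \<open>0 < B\<close>.\<close>
    case True
    have "x \<in> E" if "x \<in> space ?P" for x
      using EI[OF that, of 1 1 "{}"] True d T1 by (auto simp: disc_def)
    then have "E = space ?P"
      unfolding E_def by auto
    then show ?thesis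
      by (simp add: P.prob_space)
  next
    case False
    then have "0 < B" using B0 by simp
    have E_sets: "E \<in> sets ?P"
      unfolding E_def
      by (intro sets_ex_interval_disc_ge borel_measurable_signing[OF A] measurable_iid_component
          \<open>0 < B\<close> T1)
    have sign: "signing A x t \<in> {-1, 1}" if "x \<in> space ?P" "t \<in> {1..T}" for x t
      using measurable_space[OF measurable_signing[OF A that(2)] that(1)] by simp
    obtain L where L: "1 \<le> L" "d * 2 ^ L \<le> 2 * T" "T \<le> d * 2 ^ L"
      using exists_depth[OF d T] by blast
    interpret H: sign_system "uniform_cube d" "haar_index d L" "haar_groups d L"
        haar_group cube_haar haar_weight
      by (rule sign_system_haar[OF d])
    define n where "n = real (card (haar_groups d L))"
    have n: "n = real d * real L + 1"
      by (simp add: n_def card_haar_groups)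
    have B_le: "B \<le> sqrt n / 32"
    proof -
      have "log 2 (real T / real d) \<le> log 2 (2 ^ L)"
      proof (subst log_le_cancel_iff)
        have "real T \<le> real (d * 2 ^ L)"
          using L(3) by (simp only: of_nat_le_iff)
        then show "real T / real d \<le> 2 ^ L"
          using d by (simp add: divide_le_eq mult.commute)
      qed (use d T in auto)
      then have "log 2 (real T / real d) \<le> real L"
        by (simp add: log_nat_power)
      then have "real d * log 2 (real T / real d) \<le> real d * real L"
        by (intro mult_left_mono) auto
      then show ?thesis
        unfolding B_def n by simp
    qed
    show ?thesis
    proof (cases "n < 64")
      \<comment> \<open>With few groups the target is below 1, and the first point alone gives
        \<open>[0,1]\<close> discrepancy 1.\<close>
      case True
      then have "sqrt n < sqrt (8\<^sup>2)"
        by (intro real_sqrt_less_mono) simp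
      then have "B \<le> 1"
        using B_le by simp
      have "AE x in ?P. x \<in> E"
      proof -
        have in_E: "x \<in> E" if x: "x \<in> space ?P" "\<forall>s\<in>{1..T}. \<forall>i\<in>{1..d}. 0 \<le> x s i \<and> x s i < 1" for x
        proof (rule EI[OF x(1), of 1 1 "{0..1}"])
          have "0 \<le> x 1 1" "x 1 1 < 1"
            using x(2) d T1 by auto
          then have "disc (signing A x) x 1 1 {0..1} = 1"
            using sign[OF x(1), of 1] T1 by (auto simp: disc_def)
          then show "B \<le> disc (signing A x) x 1 1 {0..1}"
            using \<open>B \<le> 1\<close> by simp
        qed (use d T1 in auto)
        show ?thesis
          using AE_space AE_iid_points_unit by eventually_elim (rule in_E)
      qed
      then have "measure ?P E = 1"
        using E_sets by (simp add: P.prob_eq_1)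
      then show ?thesis by simp
    next
      case False
      \<comment> \<open>\<open>n >= 64\<close> gives \<open>1 <= sqrt n / 8\<close>, so even after
        an overshoot by 1 the counts are within \<open>sqrt n / 4\<close>.\<close>
      define b where "b = sqrt n / 8"
      have n64: "64 \<le> n" using False by simp
      then have "sqrt (8\<^sup>2) \<le> sqrt n"
        by (intro real_sqrt_le_mono) simp
      then have b1: "b + 1 \<le> sqrt n / 4" "0 \<le> b"
        using n64 by (auto simp: b_def)
      have B_b: "2 * B \<le> b"
        using B_le b1(2) unfolding b_def by linarith
      \<comment> \<open>Off the sample space the algorithm may return other values; this version is
        a sign everywhere, as the growth lemma demands.\<close>
      define \<epsilon> where "\<epsilon> x t = (if signing A x t = 1 then 1 else - 1 :: real)" for x t
      have \<epsilon>_eq: "\<epsilon> x t = signing A x t" if "x \<in> space ?P" "t \<in> {1..T}" for x t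
        using sign[OF that] by (auto simp: \<epsilon>_def)
      have \<epsilon>_meas: "(\<lambda>x. \<epsilon> x t) \<in> borel_measurable (\<Pi>\<^sub>M s\<in>{1..T}. uniform_cube d)" if "t \<in> {1..T}" for t
      proof -
        have [measurable]: "(\<lambda>x. signing A x t) \<in> borel_measurable (\<Pi>\<^sub>M s\<in>{1..T}. uniform_cube d)"
          using borel_measurable_signing[OF A that] by (simp add: iid_points_def)
        show ?thesis
          unfolding \<epsilon>_def by measurable
      qed
      define N where "N = {x \<in> space ?P. \<forall>t\<in>{..T}. \<forall>a\<in>haar_index d L. \<bar>H.signed_count (\<epsilon> x) x t a\<bar> \<le> b}"
      have N_sets: "N \<in> sets ?P"
        unfolding N_def iid_points_def by (rule H.sets_signed_count_bounded) (use \<epsilon>_meas in auto)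
      have "measure ?P N * (n * T) \<le> 2 * (b + 1)\<^sup>2 * card (haar_index d L)"
        unfolding N_def iid_points_def n_def
      proof (rule H.prob_signed_count_bounded_le[OF \<epsilon>_meas])
        show "\<bar>\<epsilon> x t\<bar> = 1" for x t
          by (simp add: \<epsilon>_def)
        show "\<epsilon> x t = \<epsilon> x' t" if "t \<in> {1..T}" "\<And>s. s \<in> {1..t} \<Longrightarrow> x s = x' s" for x x' t
        proof -
          have "restrict x {1..t} = restrict x' {1..t}"
            using that by (intro restrict_ext)
          then show ?thesis
            by (simp add: \<epsilon>_def signing_def)
        qed
        show "4 * b \<le> sqrt (card (haar_groups d L))"
          using b1 by (simp add: b_def n_def)
      qed (use b1 in auto)
      \<comment> \<open>Here \<open>2 * (n / 16) * (2 * T) = n * T / 4\<close> produces the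
        probability 1/4.\<close>
      also have "\<dots> \<le> 2 * (sqrt n / 4)\<^sup>2 * (2 * T)"
      proof (intro mult_mono power_mono b1)
        have "card (haar_index d L) \<le> 2 * T"
          using card_haar_index[OF d, of L] L(2) by linarith
        then show "real (card (haar_index d L)) \<le> real (2 * T)"
          by (simp only: of_nat_le_iff)
      qed (use b1 in auto)
      also have "\<dots> = 1 / 4 * (n * T)"
        using n64 by (simp add: power_divide)
      finally have "measure ?P N \<le> 1 / 4"
        using n64 T1 by (simp add: mult_le_cancel_right)
      moreover have "space ?P - E \<subseteq> N"
      proof
        fix x assume x: "x \<in> space ?P - E"
        have "\<bar>H.signed_count (\<epsilon> x) x t a\<bar> \<le> b" if t: "t \<in> {..T}" and a: "a \<in> haar_index d L" for t a
        proof (rule ccontr)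
          assume "\<not> ?thesis"
          moreover have "H.signed_count (\<epsilon> x) x t a = (\<Sum>s=1..t. signing A x s * cube_haar a (x s))"
            unfolding H.signed_count_def using x t by (intro sum.cong refl) (auto simp: \<epsilon>_eq)
          ultimately have large: "\<bar>\<Sum>s=1..t. signing A x s * cube_haar a (x s)\<bar> > 2 * B"
            using B_b by linarith
          then have "t \<noteq> 0"
            using B0 by (cases "t = 0") auto
          then have t1: "t \<in> {1..T}"
            using t by auto
          obtain i I where "i \<in> {1..d}" "is_interval I" "I \<subseteq> {0..1}" "B \<le> disc (signing A x) x i t I"
            using large_disc_of_haar_coefficient[OF d a large B0] by blast
          then show False
            using EI[of x t i I] x t1 by blast
        qed
        then show "x \<in> N"
          using x by (auto simp: N_def)
      qed
      then have "measure ?P (space ?P - E) \<le> measure ?P N"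
        using N_sets by (intro P.finite_measure_mono)
      ultimately show ?thesis
        using P.prob_compl[OF E_sets] by simp
    qed
  qed
  then show ?thesis
    unfolding E_def B_def .
qed

section \<open>From deterministic to randomized algorithms\<close>

text \<open>Fixing the seed leaves a deterministic online algorithm. The bound 3/4 is uniform in the
  seed and is integrated over it by Fubini.\<close>

lemma randomized_lower_bound:
  fixes R :: "'r measure"
  assumes d: "1 \<le> d" and T: "d \<le> T" and A: "randomized_online_algorithm R d T A"
  shows "measure (R \<Otimes>\<^sub>M iid_points d T)
            {(r, x) \<in> space (R \<Otimes>\<^sub>M iid_points d T).
               \<exists>i\<in>{1..d}. \<exists>I. is_interval I \<and> I \<subseteq> {0..1} \<and>
                 (MAX t\<in>{1..T}. disc (signing (\<lambda>t. A t r) x) x i t I)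
                   \<ge> 1 / 32 * sqrt (real d * log 2 (real T / real d))}
          \<ge> 3 / 4"
proof -
  let ?P = "iid_points d T"
  interpret P: prob_space ?P by (rule prob_space_iid_points)
  interpret R: prob_space R
    using A by (simp add: randomized_online_algorithm_def)
  interpret RP: pair_prob_space R ?P ..
  have T1: "1 \<le> T" using d T by simp
  define B where "B = 1 / 32 * sqrt (real d * log 2 (real T / real d))"
  have "0 \<le> log 2 (real T / real d)"
    using d T by (intro zero_le_log_cancel_iff[THEN iffD2]) auto
  then have B0: "0 \<le> B"
    by (simp add: B_def)
  define E where "E = {p \<in> space (R \<Otimes>\<^sub>M ?P). \<exists>i\<in>{1..d}. \<exists>I. is_interval I \<and> I \<subseteq> {0..1} \<and>
        (MAX t\<in>{1..T}. disc (signing (\<lambda>t. A t (fst p)) (snd p)) (snd p) i t I) \<ge> B}"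
  have slice: "Pair r -` E = {x \<in> space ?P. \<exists>i\<in>{1..d}. \<exists>I. is_interval I \<and> I \<subseteq> {0..1} \<and>
        (MAX t\<in>{1..T}. disc (signing (\<lambda>t. A t r) x) x i t I) \<ge> B}" if "r \<in> space R" for r
    using that by (auto simp: E_def space_pair_measure)
  have measA: "(\<lambda>(r, h). A t r h) \<in> R \<Otimes>\<^sub>M iid_points d t \<rightarrow>\<^sub>M count_space {-1, 1}" if "t \<in> {1..T}" for t
    using A that by (auto simp: randomized_online_algorithm_def)
  have slice_prob: "3 / 4 \<le> measure ?P (Pair r -` E)" if r: "r \<in> space R" for r
  proof -
    have "online_algorithm d T (\<lambda>t. A t r)"
      unfolding online_algorithm_def
    proof
      fix t assume t: "t \<in> {1..T}"
      show "A t r \<in> iid_points d t \<rightarrow>\<^sub>M count_space {-1, 1}"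
        using measurable_compose[OF measurable_Pair1'[OF r] measA[OF t]] by simp
    qed
    then show ?thesis
      unfolding slice[OF r] B_def by (rule deterministic_lower_bound[OF d T])
  qed
  have "3 / 4 \<le> measure (R \<Otimes>\<^sub>M ?P) E"
  proof (cases "B = 0")
    case True
    have zero: "(MAX t\<in>{1..T}. disc \<epsilon> x 1 t {}) \<ge> B" for \<epsilon> and x
      using T1 True by (subst Max_ge_iff) (auto simp: disc_def)
    then have "p \<in> E" if "p \<in> space (R \<Otimes>\<^sub>M ?P)" for p
      unfolding E_def using that d by (auto intro!: bexI[of _ 1] exI[of _ "{}"])
    then have "E = space (R \<Otimes>\<^sub>M ?P)"
      unfolding E_def by auto
    then show ?thesis
      by (simp add: RP.prob_space)
  next
    case False
    then have "0 < B" using B0 by simp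
    have E_sets: "E \<in> sets (R \<Otimes>\<^sub>M ?P)"
      unfolding E_def
    proof (rule sets_ex_interval_disc_ge[OF _ _ \<open>0 < B\<close> T1])
      fix s assume s: "s \<in> {1..T}"
      have restr: "(\<lambda>x. restrict x {1..s}) \<in> ?P \<rightarrow>\<^sub>M iid_points d s"
        unfolding iid_points_def using s by (intro measurable_restrict_subset) auto
      have "(\<lambda>p. (fst p, restrict (snd p) {1..s})) \<in> R \<Otimes>\<^sub>M ?P \<rightarrow>\<^sub>M R \<Otimes>\<^sub>M iid_points d s"
        using measurable_compose[OF measurable_snd restr] by (intro measurable_Pair measurable_fst)
      from measurable_compose[OF measurable_compose[OF this measA[OF s]] borel_measurable_count_space_real]
      show "(\<lambda>p. signing (\<lambda>t. A t (fst p)) (snd p) s) \<in> borel_measurable (R \<Otimes>\<^sub>M ?P)"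
        by (simp add: signing_def)
      show "(\<lambda>p. snd p s i) \<in> borel_measurable (R \<Otimes>\<^sub>M ?P)" if "i \<in> {1..d}" for i
        using measurable_compose[OF measurable_snd measurable_iid_component[OF s that]] .
    qed
    have "ennreal (3 / 4) = (\<integral>\<^sup>+ r. ennreal (3 / 4) \<partial>R)"
      by (simp add: R.emeasure_space_1)
    also have "\<dots> \<le> (\<integral>\<^sup>+ r. emeasure ?P (Pair r -` E) \<partial>R)"
      using slice_prob by (intro nn_integral_mono) (simp add: P.emeasure_eq_measure)
    also have "\<dots> = emeasure (R \<Otimes>\<^sub>M ?P) E"
      using E_sets by (rule P.emeasure_pair_measure_alt[symmetric])
    finally show ?thesis
      by (simp add: RP.emeasure_eq_measure)
  qed
  then show ?thesis
    unfolding E_def B_def by (simp add: case_prod_beta')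
qed

section \<open>The two bounds combined\<close>

theorem theorem1p2:
  shows
    "(\<exists>A. (\<forall>d\<ge>1. \<forall>T\<ge>2. online_algorithm d T (A d T)) \<and>
       (\<forall>k::nat. \<exists>C>0. \<forall>d\<ge>1. \<forall>T\<ge>2.
          measure (iid_points d T)
            {x \<in> space (iid_points d T).
               \<forall>i\<in>{1..d}. \<forall>I. is_interval I \<and> I \<subseteq> {0..1} \<longrightarrow>
                 (MAX t\<in>{1..T}. disc (signing (A d T) x) x i t I)
                   \<le> C * real d * log 2 (real T) ^ 3}
          \<ge> 1 - 1 / (real d * real T) ^ k))
     \<and>
     (\<exists>c>0. \<exists>p>0. \<forall>d\<ge>1. \<forall>T\<ge>d. \<forall>(R :: real measure) A.
        randomized_online_algorithm R d T A \<longrightarrow>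
          measure (R \<Otimes>\<^sub>M iid_points d T)
            {(r, x) \<in> space (R \<Otimes>\<^sub>M iid_points d T).
               \<exists>i\<in>{1..d}. \<exists>I. is_interval I \<and> I \<subseteq> {0..1} \<and>
                 (MAX t\<in>{1..T}. disc (signing (\<lambda>t. A t r) x) x i t I)
                   \<ge> c * sqrt (real d * log 2 (real T / real d))}
          \<ge> p)"
proof (intro conjI)
  show "\<exists>A. (\<forall>d\<ge>1. \<forall>T\<ge>2. online_algorithm d T (A d T)) \<and>
       (\<forall>k::nat. \<exists>C>0. \<forall>d\<ge>1. \<forall>T\<ge>2.
          measure (iid_points d T)
            {x \<in> space (iid_points d T).
               \<forall>i\<in>{1..d}. \<forall>I. is_interval I \<and> I \<subseteq> {0..1} \<longrightarrow>
                 (MAX t\<in>{1..T}. disc (signing (A d T) x) x i t I)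
                   \<le> C * real d * log 2 (real T) ^ 3}
          \<ge> 1 - 1 / (real d * real T) ^ k)"
  \<comment> \<open>The algorithm is fixed before the exponent \<open>k\<close>, which affects only
    the constant.\<close>
  proof (intro exI[of _ haar_greedy] conjI allI impI)
    fix k :: nat
    have "0 < 30 * (2 * real k + 9) + (4 * real k + 8)"
      by simp
    then show "\<exists>C>0. \<forall>d\<ge>1. \<forall>T\<ge>2.
          measure (iid_points d T)
            {x \<in> space (iid_points d T).
               \<forall>i\<in>{1..d}. \<forall>I. is_interval I \<and> I \<subseteq> {0..1} \<longrightarrow>
                 (MAX t\<in>{1..T}. disc (signing (haar_greedy d T) x) x i t I)
                   \<le> C * real d * log 2 (real T) ^ 3}
          \<ge> 1 - 1 / (real d * real T) ^ k"
      using haar_greedy_disc[of _ _ k] by blast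
  qed (rule online_haar_greedy)
next
  show "\<exists>c>0. \<exists>p>0. \<forall>d\<ge>1. \<forall>T\<ge>d. \<forall>(R :: real measure) A.
        randomized_online_algorithm R d T A \<longrightarrow>
          measure (R \<Otimes>\<^sub>M iid_points d T)
            {(r, x) \<in> space (R \<Otimes>\<^sub>M iid_points d T).
               \<exists>i\<in>{1..d}. \<exists>I. is_interval I \<and> I \<subseteq> {0..1} \<and>
                 (MAX t\<in>{1..T}. disc (signing (\<lambda>t. A t r) x) x i t I)
                   \<ge> c * sqrt (real d * log 2 (real T / real d))}
          \<ge> p"
    using randomized_lower_bound
    by (intro exI[of _ "1 / 32"] exI[of _ "3 / 4"] conjI allI impI) auto
qed

end
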